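(* Consider the uncertain nonholonomic system $$\dot x_0=u_0,\quad \dot x_i=u_0x_{i+1}+\phi_i(t,u,x)\ (i=1,\dots,n-1),\quad \dot x_n=u+\phi_n(t,u,x),$$ with state $(x_0,x)\in\mathbf{R}\times\mathbf{R}^n$, $x=[x_1,\dots,x_n]^{\mathrm T}$, and controls $u_0,u\in\mathbf{R}$, where Assumption 1 holds. Let $T>0$, $\gamma_0=1/T$, $\beta=\frac{2n+\delta_c}{n}+2d\Lambda$, and apply the smooth time-varying state feedback $$u_0(t)=-\frac{3}{T-t}x_0(t)-\frac{\beta}{2}(T-t),\qquad u(t)=-\beta\, b^{\mathrm T}P(\gamma(t))L_n\!\left(\tfrac{1}{T-t}\right)x(t),\qquad \gamma(t)=\frac{T}{T-t}\gamma_0 .$$ Then there exist positive constants $\upsilon_1,\upsilon_{10},\upsilon_2,\upsilon_{20}$ (independent of the initial condition) such that, for any initial condition and all $t\in[0,T)$, the closed-loop solution satisfies $$|x_0(t)|\le (T-t)^2\Big(\frac{T-t}{T^3}|x_0(0)|+\frac{\beta t}{2T}\Big),$$ $$|u_0(t)|\le (T-t)\Big(3(T-t)\Big(\frac{|x_0(0)|}{T^3}+\frac{\beta}{2T}\Big)+\beta\Big),$$ $$\|x(t)\|\le \upsilon_1 (T-t)^{3/2}e^{\upsilon_{10}|x_0(0)|t}\|x(0)\|,\qquad \|u(t)\|\le \upsilon_2(T-t)^{1/2}e^{\upsilon_{20}|x_0(0)|t}\|x(0)\|.$$ In particular all states and controls converge to zero as $t\to T$.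
   Context: Assumption 1: the functions $\phi_i(t,u,x)$ are unknown continuous functions satisfying $|\phi_i(t,u,x)|\le c_{i1}|x_1|+\cdots+c_{ii}|x_i|$ with known constants $c_{ij}\ge 0$. $L_n(\gamma)=\mathrm{diag}\{\gamma^{n-1},\dots,\gamma,1\}$. $A\in\mathbf{R}^{n\times n}$ is the matrix with ones on the superdiagonal and zeros elsewhere, $b=[0,\dots,0,1]^{\mathrm T}\in\mathbf{R}^n$, $c=[1,0,\dots,0]\in\mathbf{R}^{1\times n}$. For $\gamma>0$, $P(\gamma)$ is the unique positive definite solution of $A^{\mathrm T}P+PA-Pbb^{\mathrm T}P=-\gamma P$; $P_n=P(1)$. $\Lambda=\lambda_{\max}(P_n)$. $E_n=\mathrm{diag}\{n-1,n-2,\dots,1,0\}$ and $\delta_c=n(1+\lambda_{\max}(E_n+P_nE_nP_n^{-1}))$. With $\gamma_0=1/T$, $g_{ij}=c_{ij}T^{i+1-j}$ ($j<i$), $g_{ii}=c_{ii}T+n-i$, and $d\ge0$ is defined by $d^2=\max_{j=1,\dots,n}\sum_{i=j}^n g_{ij}^2\, i\,\gamma_0^{-2(i-j)}$. *)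

theory Defs
  imports "HOL-Analysis.Analysis"
begin

text \<open>Vectors in R^n are represented as functions nat => real, used on the index
  range {1..n}; n x n matrices as functions nat => nat => real on {1..n} x {1..n}.\<close>

definition mmul :: "nat \<Rightarrow> (nat \<Rightarrow> nat \<Rightarrow> real) \<Rightarrow> (nat \<Rightarrow> nat \<Rightarrow> real) \<Rightarrow> nat \<Rightarrow> nat \<Rightarrow> real" where
  "mmul n M N = (\<lambda>i j. \<Sum>k\<in>{1..n}. M i k * N k j)"

definition mtr :: "(nat \<Rightarrow> nat \<Rightarrow> real) \<Rightarrow> nat \<Rightarrow> nat \<Rightarrow> real" where
  "mtr M = (\<lambda>i j. M j i)"

definition mat_on :: "nat \<Rightarrow> (nat \<Rightarrow> nat \<Rightarrow> real) \<Rightarrow> bool" where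
  "mat_on n M \<longleftrightarrow> (\<forall>i j. i \<notin> {1..n} \<or> j \<notin> {1..n} \<longrightarrow> M i j = 0)"

definition Amat :: "nat \<Rightarrow> nat \<Rightarrow> nat \<Rightarrow> real" where
  "Amat n = (\<lambda>i j. if 1 \<le> i \<and> i < n \<and> j = i + 1 then 1 else 0)"

definition bvec :: "nat \<Rightarrow> nat \<Rightarrow> real" where
  "bvec n = (\<lambda>i. if i = n then 1 else 0)"

definition Lmat :: "nat \<Rightarrow> real \<Rightarrow> nat \<Rightarrow> nat \<Rightarrow> real" where
  "Lmat n g = (\<lambda>i j. if i = j \<and> i \<in> {1..n} then g ^ (n - i) else 0)"

definition Emat :: "nat \<Rightarrow> nat \<Rightarrow> nat \<Rightarrow> real" where
  "Emat n = (\<lambda>i j. if i = j \<and> i \<in> {1..n} then real (n - i) else 0)"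

definition posdef :: "nat \<Rightarrow> (nat \<Rightarrow> nat \<Rightarrow> real) \<Rightarrow> bool" where
  "posdef n M \<longleftrightarrow> (\<forall>i\<in>{1..n}. \<forall>j\<in>{1..n}. M i j = M j i) \<and>
     (\<forall>v. (\<exists>i\<in>{1..n}. v i \<noteq> 0) \<longrightarrow> (\<Sum>i\<in>{1..n}. \<Sum>j\<in>{1..n}. v i * M i j * v j) > 0)"

definition riccati_sol :: "nat \<Rightarrow> real \<Rightarrow> (nat \<Rightarrow> nat \<Rightarrow> real) \<Rightarrow> bool" where
  "riccati_sol n g P \<longleftrightarrow> mat_on n P \<and> posdef n P \<and>
     (\<forall>i\<in>{1..n}. \<forall>j\<in>{1..n}.
        mmul n (mtr (Amat n)) P i j + mmul n P (Amat n) i j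
        - mmul n (mmul n P (\<lambda>k l. bvec n k * bvec n l)) P i j = - g * P i j)"

definition Pmat :: "nat \<Rightarrow> real \<Rightarrow> nat \<Rightarrow> nat \<Rightarrow> real" where
  "Pmat n g = (THE P. riccati_sol n g P)"

definition minv :: "nat \<Rightarrow> (nat \<Rightarrow> nat \<Rightarrow> real) \<Rightarrow> nat \<Rightarrow> nat \<Rightarrow> real" where
  "minv n M = (THE Q. mat_on n Q \<and>
     (\<forall>i\<in>{1..n}. \<forall>j\<in>{1..n}. mmul n M Q i j = (if i = j then 1 else 0)
                               \<and> mmul n Q M i j = (if i = j then 1 else 0)))"

definition eigvals :: "nat \<Rightarrow> (nat \<Rightarrow> nat \<Rightarrow> real) \<Rightarrow> real set" where
  "eigvals n M = {lam. \<exists>v. (\<exists>i\<in>{1..n}. v i \<noteq> 0) \<and>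
       (\<forall>i\<in>{1..n}. (\<Sum>j\<in>{1..n}. M i j * v j) = lam * v i)}"

definition lam_max :: "nat \<Rightarrow> (nat \<Rightarrow> nat \<Rightarrow> real) \<Rightarrow> real" where
  "lam_max n M = Max (eigvals n M)"

definition Lambda :: "nat \<Rightarrow> real" where
  "Lambda n = lam_max n (Pmat n 1)"

definition delta_c :: "nat \<Rightarrow> real" where
  "delta_c n = real n * (1 + lam_max n (\<lambda>i j. Emat n i j
       + mmul n (mmul n (Pmat n 1) (Emat n)) (minv n (Pmat n 1)) i j))"

text \<open>g_ij and d (with gamma_0 = 1/T)\<close>
definition gcoef :: "nat \<Rightarrow> (nat \<Rightarrow> nat \<Rightarrow> real) \<Rightarrow> real \<Rightarrow> nat \<Rightarrow> nat \<Rightarrow> real" where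
  "gcoef n c T i j = (if j < i then c i j * T ^ (i + 1 - j) else c i i * T + real (n - i))"

definition dconst :: "nat \<Rightarrow> (nat \<Rightarrow> nat \<Rightarrow> real) \<Rightarrow> real \<Rightarrow> real" where
  "dconst n c T = sqrt (Max ((\<lambda>j. \<Sum>i\<in>{j..n}. (gcoef n c T i j)\<^sup>2 * real i
                                   * inverse ((1 / T) ^ (2 * (i - j)))) ` {1..n}))"

definition beta_gain :: "nat \<Rightarrow> (nat \<Rightarrow> nat \<Rightarrow> real) \<Rightarrow> real \<Rightarrow> real" where
  "beta_gain n c T = (2 * real n + delta_c n) / real n + 2 * dconst n c T * Lambda n"

definition u0_fb :: "real \<Rightarrow> real \<Rightarrow> real \<Rightarrow> real \<Rightarrow> real" where
  "u0_fb T b t x0 = - 3 / (T - t) * x0 - b / 2 * (T - t)"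

definition u_fb :: "nat \<Rightarrow> real \<Rightarrow> real \<Rightarrow> real \<Rightarrow> (nat \<Rightarrow> real) \<Rightarrow> real" where
  "u_fb n T b t x = - b * (\<Sum>j\<in>{1..n}. \<Sum>k\<in>{1..n}.
       bvec n k * Pmat n (T / (T - t) * (1 / T)) k j *
       (\<Sum>l\<in>{1..n}. Lmat n (1 / (T - t)) j l * x l))"

definition vnorm :: "nat \<Rightarrow> (nat \<Rightarrow> real) \<Rightarrow> real" where
  "vnorm n x = sqrt (\<Sum>i\<in>{1..n}. (x i)\<^sup>2)"

end

theory Submission
  imports Defs "Jordan_Normal_Form.Spectral_Radius"
begin

text \<open>With \<open>L\<^sub>k\<^sub>i = C(n-k, n-i)\<close> one has \<open>P\<^sub>n = L\<^sup>T L\<close>, the inverse of \<open>P\<^sub>n\<close> is the signed Pascal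
  matrix, and \<open>P(\<gamma>)\<^sub>i\<^sub>j = \<gamma>\<^sup>2\<^sup>n\<^sup>+\<^sup>1\<^sup>-\<^sup>i\<^sup>-\<^sup>j (P\<^sub>n)\<^sub>i\<^sub>j\<close>. In the coordinates \<open>w\<^sub>i = x\<^sub>i / (T - t)\<^sup>2\<^sup>(\<^sup>n\<^sup>-\<^sup>i\<^sup>)\<close> the
  closed loop becomes \<open>1 / (T - t)\<close> times a time-invariant system, up to a bounded term coming from the
  explicit solution of the \<open>x\<^sub>0\<close>-equation. The gain \<open>\<beta>\<close> is chosen so that \<open>W = w\<^sup>T P\<^sub>n w\<close> satisfies
  \<open>W' \<le> (a - 3 / (T - t)) W\<close> with \<open>a\<close> at most affine in \<open>|x\<^sub>0(0)|\<close>, hence \<open>W\<close> decays like \<open>(T - t)\<^sup>3\<close>.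
  The perturbation enters through \<open>2 d \<Lambda> W\<close>, which requires \<open>\<lambda>\<^sub>m\<^sub>i\<^sub>n(P\<^sub>n) \<ge> 1 / \<Lambda>\<close>.\<close>

subsection \<open>The Riccati equation and the Pascal matrix\<close>

definition Lbin :: "nat \<Rightarrow> nat \<Rightarrow> nat \<Rightarrow> real" where
  "Lbin n k i = real ((n - k) choose (n - i))"

definition Pbin :: "nat \<Rightarrow> nat \<Rightarrow> nat \<Rightarrow> real" where
  "Pbin n i j = (if i \<in> {1..n} \<and> j \<in> {1..n} then \<Sum>k\<in>{1..n}. Lbin n k i * Lbin n k j else 0)"

definition Qbin :: "nat \<Rightarrow> nat \<Rightarrow> nat \<Rightarrow> real" where
  "Qbin n i j = (if i \<in> {1..n} \<and> j \<in> {1..n}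
     then (-1) ^ (i + j) * real (((n - i) + (n - j)) choose (n - i)) else 0)"

lemma mat_on_zero:
  assumes "mat_on n M" "i \<notin> {1..n} \<or> j \<notin> {1..n}"
  shows "M i j = 0"
  using assms unfolding mat_on_def by blast

lemma mmul_Amat_right:
  assumes "mat_on n M" "i \<in> {1..n}" "j \<in> {1..n}"
  shows "mmul n M (Amat n) i j = M i (j - 1)"
proof (cases "j = 1")
  case True
  then show ?thesis
    using mat_on_zero[OF assms(1), of i 0] by (auto simp: mmul_def Amat_def intro!: sum.neutral)
next
  case False
  have "mmul n M (Amat n) i j = (\<Sum>k\<in>{1..n}. if k = j - 1 then M i k else 0)"
    unfolding mmul_def Amat_def using assms False by (intro sum.cong) auto
  also have "\<dots> = M i (j - 1)" using assms False by (subst sum.delta) auto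
  finally show ?thesis .
qed

lemma mmul_Amat_left:
  assumes "mat_on n M" "i \<in> {1..n}" "j \<in> {1..n}"
  shows "mmul n (mtr (Amat n)) M i j = M (i - 1) j"
proof -
  have "mat_on n (mtr M)" using assms(1) by (auto simp: mat_on_def mtr_def)
  moreover have "mmul n (mtr (Amat n)) M i j = mmul n (mtr M) (Amat n) j i"
    by (simp add: mmul_def mtr_def mult.commute)
  ultimately show ?thesis using mmul_Amat_right[of n "mtr M" j i] assms by (simp add: mtr_def)
qed

lemma mmul_bvec:
  assumes "n \<ge> 1"
  shows "mmul n (mmul n M (\<lambda>k l. bvec n k * bvec n l)) M i j = M i n * M n j"
proof -
  have *: "(\<Sum>k\<in>{1..n}. f k * bvec n k) = f n" for f
  proof -
    have "(\<Sum>k\<in>{1..n}. f k * bvec n k) = (\<Sum>k\<in>{1..n}. if k = n then f k else 0)"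
      by (intro sum.cong) (auto simp: bvec_def)
    then show ?thesis using assms by (simp add: sum.delta)
  qed
  have "mmul n M (\<lambda>k l. bvec n k * bvec n l) i l = M i n * bvec n l" for l
    unfolding mmul_def using *[of "\<lambda>k. M i k * bvec n l"] by (simp only: mult.assoc mult.commute[of "bvec n l"])
  then show ?thesis
    unfolding mmul_def[of n "mmul n M _"] using *[of "\<lambda>k. M i n * M k j"]
    by (simp only: mult.assoc mult.commute[of "M _ j"])
qed

lemma riccati_sol_entries:
  assumes "n \<ge> 1"
  shows "riccati_sol n g P \<longleftrightarrow> mat_on n P \<and> posdef n P \<and>
    (\<forall>i\<in>{1..n}. \<forall>j\<in>{1..n}. P (i - 1) j + P i (j - 1) - P i n * P n j = - g * P i j)"
  unfolding riccati_sol_def using mmul_Amat_left mmul_Amat_right mmul_bvec[OF assms]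
  by (auto simp del: One_nat_def)

lemma mat_on_Pbin: "mat_on n (Pbin n)" and mat_on_Qbin: "mat_on n (Qbin n)"
  by (auto simp: mat_on_def Pbin_def Qbin_def)

lemma Pbin_sym: "Pbin n i j = Pbin n j i"
  by (auto simp: Pbin_def mult.commute)

lemma Qbin_sym: "Qbin n i j = Qbin n j i"
  unfolding Qbin_def using binomial_symmetric[of "n - i" "n - i + (n - j)"]
  by (simp only: add.commute[of j] add.commute[of "n - j"] le_add1 diff_add_inverse conj_commute)

lemma sum_choose_mult_telescope:
  "(\<Sum>m<n. real (m choose Suc p) * real (m choose q) + real (m choose p) * real (m choose Suc q)
     + real (m choose p) * real (m choose q)) = real (n choose Suc p) * real (n choose Suc q)"
  by (induction n) (auto simp: algebra_simps)

lemma sum_choose_lessThan: "(\<Sum>m<n. real (m choose p)) = real (n choose Suc p)"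
  by (induction n) auto

lemma Pbin_eq:
  assumes "i \<le> n" "j \<le> n"
  shows "Pbin n i j = (\<Sum>m<n. real (m choose (n - i)) * real (m choose (n - j)))"
proof (cases "i = 0 \<or> j = 0")
  case True
  then show ?thesis by (auto simp: Pbin_def intro!: sum.neutral)
next
  case False
  have "(\<Sum>k\<in>{1..n}. real (n - k choose (n - i)) * real (n - k choose (n - j)))
      = (\<Sum>m<n. real (m choose (n - i)) * real (m choose (n - j)))"
    by (rule sum.reindex_bij_witness[of _ "\<lambda>m. n - m" "\<lambda>k. n - k"]) auto
  then show ?thesis using False assms by (auto simp: Pbin_def Lbin_def)
qed

lemma Pbin_last_row:
  assumes "j \<in> {1..n}"
  shows "Pbin n n j = real (n choose Suc (n - j))"
  using assms by (simp add: Pbin_eq sum_choose_lessThan)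

lemma Pbin_riccati:
  assumes "i \<in> {1..n}" "j \<in> {1..n}"
  shows "Pbin n (i - 1) j + Pbin n i (j - 1) - Pbin n i n * Pbin n n j = - Pbin n i j"
proof -
  have 1: "n - (i - 1) = Suc (n - i)" "n - (j - 1) = Suc (n - j)" "i - 1 \<le> n" "j - 1 \<le> n" "i \<le> n" "j \<le> n"
    using assms by auto
  have "Pbin n (i - 1) j + Pbin n i (j - 1) + Pbin n i j = Pbin n n i * Pbin n n j"
    using sum_choose_mult_telescope[of "n - i" "n - j" n]
    unfolding Pbin_last_row[OF assms(1)] Pbin_last_row[OF assms(2)]
      Pbin_eq[OF 1(3,6)] Pbin_eq[OF 1(5,4)] Pbin_eq[OF 1(5,6)] 1(1,2) by (simp add: sum.distrib)
  then show ?thesis by (simp add: Pbin_sym[of n i n])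
qed

lemma Qbin_lyapunov:
  assumes "i \<in> {1..n}" "j \<in> {1..n}"
  shows "Qbin n (Suc i) j + Qbin n i (Suc j) + Qbin n i j = (if i = n \<and> j = n then 1 else 0)"
proof -
  consider "i = n" "j = n" | "i = n" "j < n" | "i < n" "j = n" | "i < n" "j < n"
    using assms by force
  then show ?thesis
  proof cases
    case 4
    define p q where "p = n - Suc i" and "q = n - Suc j"
    have "n - i = Suc p" "n - j = Suc q" "n - Suc i = p" "n - Suc j = q"
      using 4 by (auto simp: p_def q_def)
    then show ?thesis using 4 assms by (simp add: Qbin_def algebra_simps)
  qed (use assms in \<open>auto simp: Qbin_def\<close>)
qed

lemma Qbin_right_inverse:
  assumes P: "mat_on n P" and P1n: "P 1 n \<noteq> 0"
    and ric: "\<And>i j. i \<in> {1..n} \<Longrightarrow> j \<in> {1..n} \<Longrightarrow>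
       P (i - 1) j + P i (j - 1) - P i n * P n j = - P i j"
    and ij: "i \<in> {1..n}" "j \<in> {1..n}"
  shows "mmul n P (Qbin n) i j = (if i = j then 1 else 0)"
proof -
  define Y where "Y i j = mmul n P (Qbin n) i j - (if i = j then 1 else 0)" for i j
  have n: "n \<ge> 1" using ij by auto
  have step: "Y (i - 1) j - P i n * Y n j = Y i (Suc j)" if i: "i \<in> {1..n}" and j: "j \<in> {1..n}" for i j
  proof -
    have "(\<Sum>k\<in>{1..n}. P i (k - 1) * Qbin n k j) = (\<Sum>k\<in>{0..n}. P i k * Qbin n (Suc k) j)"
    proof -
      have "(\<Sum>k\<in>{0..n}. P i k * Qbin n (Suc k) j) = (\<Sum>k\<in>{1..Suc n}. P i (k - 1) * Qbin n k j)"
        by (rule sum.reindex_bij_witness[of _ "\<lambda>k. k - 1" Suc]) auto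
      also have "\<dots> = (\<Sum>k\<in>{1..n}. P i (k - 1) * Qbin n k j)"
        by (simp add: mat_on_zero[OF mat_on_Qbin])
      finally show ?thesis ..
    qed
    also have "\<dots> = (\<Sum>k\<in>{1..n}. P i k * Qbin n (Suc k) j)"
      using n mat_on_zero[OF P, of i 0] by (simp add: sum.atLeast_Suc_atMost[of 0])
    finally have shift: "(\<Sum>k\<in>{1..n}. P i (k - 1) * Qbin n k j) = (\<Sum>k\<in>{1..n}. P i k * Qbin n (Suc k) j)" .
    have "0 = (\<Sum>k\<in>{1..n}. (P (i - 1) k + P i (k - 1) - P i n * P n k + P i k) * Qbin n k j)"
      using ric[OF i] by (intro sum.neutral[symmetric]) (auto simp: algebra_simps)
    also have "\<dots> = mmul n P (Qbin n) (i - 1) j + (\<Sum>k\<in>{1..n}. P i k * Qbin n (Suc k) j)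
        - P i n * mmul n P (Qbin n) n j + mmul n P (Qbin n) i j"
      unfolding shift[symmetric] mmul_def
      by (simp add: algebra_simps sum.distrib sum_subtractf sum_distrib_left)
    finally have 1: "0 = \<dots>" .
    have "(if j = n then P i n else 0) = (\<Sum>k\<in>{1..n}. if k = n then P i k * (if j = n then 1 else 0) else 0)"
      using n by (subst sum.delta) auto
    also have "\<dots> = (\<Sum>k\<in>{1..n}. P i k * (Qbin n (Suc k) j + Qbin n k (Suc j) + Qbin n k j))"
      using Qbin_lyapunov[OF _ j] by (intro sum.cong) auto
    also have "\<dots> = (\<Sum>k\<in>{1..n}. P i k * Qbin n (Suc k) j) + mmul n P (Qbin n) i (Suc j)
        + mmul n P (Qbin n) i j"
      unfolding mmul_def by (simp add: algebra_simps sum.distrib)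
    finally have 2: "(if j = n then P i n else 0) = \<dots>" .
    have "(i - 1 = j) = (i = Suc j)" using i by auto
    moreover have "P i n * Y n j = P i n * mmul n P (Qbin n) n j - (if j = n then P i n else 0)"
      by (simp add: Y_def right_diff_distrib)
    ultimately show ?thesis using 1 2 unfolding Y_def by (simp only:)
  qed
  have "\<forall>i\<in>{0..n}. Y i j = 0" if "j \<ge> 1" "j \<le> Suc n" for j
    using that(2,1)
  proof (induction j rule: inc_induct)
    case base
    then show ?case by (auto simp: Y_def mmul_def mat_on_zero[OF mat_on_Qbin])
  next
    case (step j)
    then have *: "Y (i - 1) j - P i n * Y n j = 0" if "i \<in> {1..n}" for i
      using \<open>\<And>i j. i \<in> {1..n} \<Longrightarrow> j \<in> {1..n} \<Longrightarrow> Y (i - 1) j - P i n * Y n j = Y i (Suc j)\<close>[OF that, of j] that by auto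
    have "Y 0 j = 0" using step by (auto simp: Y_def mmul_def mat_on_zero[OF P])
    then have Yn: "Y n j = 0" using *[of 1] n P1n by auto
    show ?case
    proof
      fix i assume "i \<in> {0..n}"
      then show "Y i j = 0" using *[of "Suc i"] Yn by (cases "i = n") auto
    qed
  qed
  then have "Y i j = 0" using ij by auto
  then show ?thesis by (simp add: Y_def)
qed

lemma Pbin_Qbin:
  assumes "i \<in> {1..n}" "j \<in> {1..n}"
  shows "mmul n (Pbin n) (Qbin n) i j = (if i = j then 1 else 0)"
    and "mmul n (Qbin n) (Pbin n) i j = (if i = j then 1 else 0)"
proof -
  have *: "mmul n (Pbin n) (Qbin n) i j = (if i = j then 1 else 0)" if "i \<in> {1..n}" "j \<in> {1..n}" for i j
    using that mat_on_Pbin Pbin_riccati Pbin_last_row[of 1 n]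
    by (intro Qbin_right_inverse) (auto simp: Pbin_sym[of n 1 n] simp del: One_nat_def)
  show "mmul n (Pbin n) (Qbin n) i j = (if i = j then 1 else 0)" by (rule *[OF assms])
  show "mmul n (Qbin n) (Pbin n) i j = (if i = j then 1 else 0)"
    using *[OF assms(2,1)] by (auto simp: mmul_def Pbin_sym[of n j] Qbin_sym[of n i] mult.commute)
qed

subsection \<open>Quadratic forms and Rayleigh quotients\<close>

definition mv :: "nat \<Rightarrow> (nat \<Rightarrow> nat \<Rightarrow> real) \<Rightarrow> (nat \<Rightarrow> real) \<Rightarrow> nat \<Rightarrow> real" where
  "mv n M v = (\<lambda>i. \<Sum>j\<in>{1..n}. M i j * v j)"

definition dot :: "nat \<Rightarrow> (nat \<Rightarrow> real) \<Rightarrow> (nat \<Rightarrow> real) \<Rightarrow> real" where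
  "dot n v w = (\<Sum>i\<in>{1..n}. v i * w i)"

lemma posdef_iff:
  "posdef n M \<longleftrightarrow> (\<forall>i\<in>{1..n}. \<forall>j\<in>{1..n}. M i j = M j i) \<and>
     (\<forall>v. (\<exists>i\<in>{1..n}. v i \<noteq> 0) \<longrightarrow> dot n v (mv n M v) > 0)"
  by (simp add: posdef_def dot_def mv_def sum_distrib_left mult.assoc)

lemma mv_mv: "mv n M (mv n N v) = mv n (mmul n M N) v"
proof
  fix i
  have "mv n M (mv n N v) i = (\<Sum>j\<in>{1..n}. \<Sum>k\<in>{1..n}. M i j * N j k * v k)"
    by (simp add: mv_def sum_distrib_left mult.assoc)
  also have "\<dots> = mv n (mmul n M N) v i"
    by (subst sum.swap) (simp add: mv_def mmul_def sum_distrib_right)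
  finally show "mv n M (mv n N v) i = mv n (mmul n M N) v i" .
qed

lemma mv_add: "mv n M (\<lambda>i. v i + w i) = (\<lambda>i. mv n M v i + mv n M w i)"
  by (rule ext) (simp add: mv_def algebra_simps sum.distrib)

lemma mv_scale: "mv n M (\<lambda>i. a * v i) = (\<lambda>i. a * mv n M v i)"
  by (rule ext) (simp add: mv_def sum_distrib_left mult_ac)

lemma mv_cong: "(\<And>j. j \<in> {1..n} \<Longrightarrow> v j = w j) \<Longrightarrow> mv n M v = mv n M w"
  unfolding mv_def by (intro ext sum.cong) auto

lemma dot_cong:
  "(\<And>j. j \<in> {1..n} \<Longrightarrow> v j = v' j) \<Longrightarrow> (\<And>j. j \<in> {1..n} \<Longrightarrow> w j = w' j) \<Longrightarrow> dot n v w = dot n v' w'"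
  unfolding dot_def by (intro sum.cong) auto

lemma dot_commute: "dot n v w = dot n w v"
  by (simp add: dot_def mult.commute)

lemma dot_add_left: "dot n (\<lambda>i. u i + v i) w = dot n u w + dot n v w"
  by (simp add: dot_def algebra_simps sum.distrib)

lemma dot_scale_left: "dot n (\<lambda>i. a * v i) w = a * dot n v w"
  by (simp add: dot_def sum_distrib_left mult_ac)

lemma dot_add_right: "dot n w (\<lambda>i. u i + v i) = dot n w u + dot n w v"
  by (simp add: dot_def algebra_simps sum.distrib)

lemma dot_scale_right: "dot n w (\<lambda>i. a * v i) = a * dot n w v"
  by (simp add: dot_def sum_distrib_left mult_ac)

lemma dot_self_nonneg: "dot n v v \<ge> 0"
  unfolding dot_def by (intro sum_nonneg) auto

lemma dot_self_pos:
  assumes "\<exists>i\<in>{1..n}. v i \<noteq> 0"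
  shows "dot n v v > 0"
proof -
  obtain i where "i \<in> {1..n}" "v i \<noteq> 0" using assms by auto
  then show ?thesis unfolding dot_def by (intro sum_pos2[of _ i]) (auto simp flip: power2_eq_square)
qed

lemma vnorm_dot: "vnorm n v = sqrt (dot n v v)"
  by (simp add: vnorm_def dot_def power2_eq_square)

lemma Cauchy_Schwarz_dot: "(dot n v w)\<^sup>2 \<le> dot n v v * dot n w w"
  using Cauchy_Schwarz_ineq_sum[of v w "{1..n}"] by (simp add: dot_def power2_eq_square)

lemma dot_mv_transpose: "dot n v (mv n M w) = dot n (mv n (mtr M) v) w"
proof -
  have "dot n v (mv n M w) = (\<Sum>i\<in>{1..n}. \<Sum>j\<in>{1..n}. v i * M i j * w j)"
    by (simp add: dot_def mv_def sum_distrib_left mult.assoc)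
  also have "\<dots> = dot n (mv n (mtr M) v) w"
    by (subst sum.swap) (simp add: dot_def mv_def mtr_def sum_distrib_right sum_distrib_left mult_ac)
  finally show ?thesis .
qed

lemma dot_mv_sym:
  assumes "\<And>i j. i \<in> {1..n} \<Longrightarrow> j \<in> {1..n} \<Longrightarrow> M i j = M j i"
  shows "dot n v (mv n M w) = dot n w (mv n M v)"
proof -
  have "dot n (mv n (mtr M) v) w = dot n (mv n M v) w"
    using assms by (auto simp: dot_def mv_def mtr_def intro!: sum.cong)
  then show ?thesis by (simp add: dot_mv_transpose[of n v] dot_commute[of n w])
qed

lemma dot_unit:
  assumes "i \<in> {1..n}"
  shows "dot n (\<lambda>k. if k = i then 1 else 0) w = w i"
proof -
  have "dot n (\<lambda>k. if k = i then 1 else 0) w = (\<Sum>k\<in>{1..n}. if k = i then w k else 0)"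
    unfolding dot_def by (intro sum.cong) auto
  then show ?thesis using assms by (simp add: sum.delta)
qed

lemma mv_unit:
  assumes "i \<in> {1..n}"
  shows "mv n M (\<lambda>k. if k = i then 1 else 0) j = M j i"
  using dot_unit[OF assms, of "M j"] by (simp add: mv_def dot_def mult.commute)

lemma psd_kernel:
  assumes sym: "\<And>i j. i \<in> {1..n} \<Longrightarrow> j \<in> {1..n} \<Longrightarrow> M i j = M j i"
    and psd: "\<And>y. dot n y (mv n M y) \<ge> 0"
    and v: "dot n v (mv n M v) = 0"
    and i: "i \<in> {1..n}"
  shows "mv n M v i = 0"
proof (rule ccontr)
  assume nz: "mv n M v i \<noteq> 0"
  define e where "e k = (if k = i then 1 else 0 :: real)" for k
  define a b where "a = mv n M v i" and "b = M i i"
  have q: "0 \<le> 2 * t * a + t\<^sup>2 * b" for t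
  proof -
    have "dot n v (mv n M e) = a" "dot n e (mv n M v) = a" "dot n e (mv n M e) = b"
      using dot_mv_sym[of n M v e, OF sym] dot_unit[OF i] mv_unit[OF i]
      unfolding e_def a_def b_def by auto
    then have "dot n (\<lambda>k. v k + t * e k) (mv n M (\<lambda>k. v k + t * e k)) = 2 * t * a + t\<^sup>2 * b"
      using v by (simp add: mv_add mv_scale dot_add_left dot_add_right dot_scale_left dot_scale_right
          power2_eq_square algebra_simps)
    then show ?thesis using psd by metis
  qed
  define B where "B = \<bar>b\<bar> + 1"
  have "B > 0" "b < B" unfolding B_def by auto
  have "2 * (- a / B) * a + (- a / B)\<^sup>2 * b = a\<^sup>2 / B * (b / B - 2)"
    using \<open>B > 0\<close> by (simp add: field_simps power2_eq_square)
  moreover have "a\<^sup>2 / B > 0" "b / B - 2 < 0"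
    using nz \<open>B > 0\<close> \<open>b < B\<close> by (auto simp: a_def field_simps)
  ultimately show False using q[of "- a / B"] mult_pos_neg[of "a\<^sup>2 / B" "b / B - 2"] by linarith
qed

lemma compact_unit_vectors:
  "compact {v :: nat \<Rightarrow> real. (\<forall>i. i \<notin> {1..n} \<longrightarrow> v i = 0) \<and> dot n v v = 1}" (is "compact ?K")
proof -
  let ?S = "\<lambda>i. if i \<in> {1..n} then {-1..1} else {0::real}"
  have 1: "compact (PiE UNIV ?S)"
    using compactin_PiE[of "\<lambda>_::nat. euclidean :: real topology" UNIV ?S]
    by (auto simp: euclidean_product_topology)
  have "closed {v :: nat \<Rightarrow> real. dot n v v = 1}"
    unfolding dot_def
    by (intro closed_Collect_eq continuous_on_sum continuous_on_mult continuous_on_const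
        continuous_on_product_coordinates)
  with 1 have "compact (PiE UNIV ?S \<inter> {v. dot n v v = 1})" by (rule compact_Int_closed)
  also have "PiE UNIV ?S \<inter> {v. dot n v v = 1} = ?K"
  proof -
    have "v i \<in> ?S i" if "v \<in> ?K" for v i
    proof (cases "i \<in> {1..n}")
      case True
      then have "v i * v i \<le> dot n v v"
        unfolding dot_def by (intro member_le_sum) auto
      then have "(v i)\<^sup>2 \<le> 1" using that by (simp add: power2_eq_square)
      then show ?thesis using True by (auto simp: abs_le_iff dest: power2_le_imp_le simp flip: abs_le_square_iff[of _ 1, simplified])
    qed (use that in auto)
    moreover have "v i = 0" if "v \<in> PiE UNIV ?S" "i \<notin> {1..n}" for v i
    proof -
      have "v i \<in> ?S i" using that(1) by blast
      then show ?thesis using that(2) by (simp split: if_splits)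
    qed
    ultimately show ?thesis by (blast intro: PiE_I)
  qed
  finally show ?thesis .
qed

lemma Rayleigh_quotient_max:
  assumes n: "n \<ge> 1"
    and S: "\<And>i j. i \<in> {1..n} \<Longrightarrow> j \<in> {1..n} \<Longrightarrow> S i j = S j i"
    and P: "posdef n P"
  obtains lam v where "\<exists>i\<in>{1..n}. v i \<noteq> 0"
    "\<And>i. i \<in> {1..n} \<Longrightarrow> mv n S v i = lam * mv n P v i"
    "\<And>y. dot n y (mv n S y) \<le> lam * dot n y (mv n P y)"
proof -
  define K where "K = {v :: nat \<Rightarrow> real. (\<forall>i. i \<notin> {1..n} \<longrightarrow> v i = 0) \<and> dot n v v = 1}"
  define f where "f v = dot n v (mv n S v) / dot n v (mv n P v)" for v
  have nz: "\<exists>i\<in>{1..n}. v i \<noteq> 0" if "dot n v v = 1" for v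
  proof (rule ccontr)
    assume "\<not> (\<exists>i\<in>{1..n}. v i \<noteq> 0)"
    then have "dot n v v = 0" by (simp add: dot_def)
    then show False using that by simp
  qed
  have Ppos: "dot n v (mv n P v) > 0" if "\<exists>i\<in>{1..n}. v i \<noteq> 0" for v
    using P that by (simp add: posdef_iff)
  have 1: "1 \<in> {1..n}" using n by simp
  define e :: "nat \<Rightarrow> real" where "e = (\<lambda>k. if k = 1 then 1 else 0)"
  have "dot n e e = e 1" using dot_unit[OF 1, of e] by (simp only: e_def[symmetric])
  also have "\<dots> = 1" by (simp add: e_def)
  finally have "dot n e e = 1" .
  moreover have "\<forall>i. i \<notin> {1..n} \<longrightarrow> e i = 0" using n by (auto simp: e_def)
  ultimately have "e \<in> K" by (simp add: K_def)
  moreover have "continuous_on K f"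
    unfolding f_def
  proof (rule continuous_on_divide)
    have "continuous_on K (\<lambda>v. v i)" for i
      by (rule continuous_on_subset[OF continuous_on_product_coordinates subset_UNIV])
    then have cont: "continuous_on K (\<lambda>v. dot n v (mv n M v))" for M
      unfolding dot_def mv_def by (intro continuous_on_sum continuous_on_mult continuous_on_const)
    show "continuous_on K (\<lambda>v. dot n v (mv n S v))" "continuous_on K (\<lambda>v. dot n v (mv n P v))"
      by (rule cont)+
    show "\<forall>v\<in>K. dot n v (mv n P v) \<noteq> 0"
    proof
      fix v assume "v \<in> K"
      then have "dot n v v = 1" by (simp add: K_def)
      from Ppos[OF nz[OF this]] show "dot n v (mv n P v) \<noteq> 0" by simp
    qed
  qed
  ultimately obtain v where v: "v \<in> K" and vmax: "\<And>y. y \<in> K \<Longrightarrow> f y \<le> f v"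
    using continuous_attains_sup[of K f] compact_unit_vectors[of n] unfolding K_def by blast
  define lam where "lam = f v"
  have max: "dot n y (mv n S y) \<le> lam * dot n y (mv n P y)" for y
  proof (cases "\<exists>i\<in>{1..n}. y i \<noteq> 0")
    case False
    then have "dot n y w = 0" for w by (auto simp: dot_def intro!: sum.neutral)
    then show ?thesis by simp
  next
    case True
    define r where "r = 1 / sqrt (dot n y y)"
    define z where "z i = (if i \<in> {1..n} then r * y i else 0)" for i
    have yy: "dot n y y > 0" using dot_self_pos[OF True] .
    have zdot: "dot n z (mv n M z) = r\<^sup>2 * dot n y (mv n M y)" for M
    proof -
      have "mv n M z = mv n M (\<lambda>i. r * y i)" by (rule mv_cong) (simp add: z_def)
      then have "dot n z (mv n M z) = dot n (\<lambda>i. r * y i) (\<lambda>i. r * mv n M y i)"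
        by (intro dot_cong) (auto simp: z_def mv_scale)
      then show ?thesis by (simp add: dot_scale_left dot_scale_right power2_eq_square)
    qed
    have "dot n z z = dot n (\<lambda>i. r * y i) (\<lambda>i. r * y i)" by (intro dot_cong) (auto simp: z_def)
    also have "\<dots> = 1" unfolding dot_scale_left dot_scale_right r_def using yy by (simp add: field_simps)
    finally have "z \<in> K" by (simp add: K_def z_def)
    then have "f z \<le> lam" unfolding lam_def by (rule vmax)
    moreover have "f z = f y" using yy by (simp add: f_def zdot r_def)
    ultimately have "f y \<le> lam" by simp
    then show ?thesis using Ppos[OF True] by (simp add: f_def pos_divide_le_eq)
  qed
  have vnz: "\<exists>i\<in>{1..n}. v i \<noteq> 0" using v nz by (auto simp: K_def)
  have "mv n S v i = lam * mv n P v i" if i: "i \<in> {1..n}" for i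
  proof -
    define M where "M i j = lam * P i j - S i j" for i j
    have Mmv: "mv n M y = (\<lambda>i. lam * mv n P y i + (-1) * mv n S y i)" for y
      by (simp add: M_def mv_def sum_distrib_left sum_subtractf sum_negf left_diff_distrib mult.assoc)
    have Mdot: "dot n y (mv n M y) = lam * dot n y (mv n P y) - dot n y (mv n S y)" for y
      unfolding Mmv dot_add_right dot_scale_right by simp
    have "mv n M v i = 0"
    proof (rule psd_kernel[OF _ _ _ i])
      show "M i j = M j i" if "i \<in> {1..n}" "j \<in> {1..n}" for i j
        using S[OF that] P that by (simp add: M_def posdef_def)
      show "dot n y (mv n M y) \<ge> 0" for y using max[of y] by (simp add: Mdot)
      show "dot n v (mv n M v) = 0" using Ppos[OF vnz] by (simp add: Mdot lam_def f_def)
    qed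
    then show ?thesis by (simp add: Mmv)
  qed
  then show ?thesis using that vnz max by blast
qed

lemma finite_eigvals: "finite (eigvals n M)"
proof -
  define A where "A = Matrix.mat n n (\<lambda>(i, j). M (Suc i) (Suc j))"
  have A: "A \<in> carrier_mat n n" by (simp add: A_def)
  have "eigvals n M \<subseteq> spectrum A"
  proof
    fix lam assume "lam \<in> eigvals n M"
    then obtain v i where v: "i \<in> {1..n}" "v i \<noteq> 0"
      "\<forall>i\<in>{1..n}. (\<Sum>j\<in>{1..n}. M i j * v j) = lam * v i"
      unfolding eigvals_def by blast
    define w where "w = Matrix.vec n (\<lambda>i. v (Suc i))"
    have "Matrix.vec_index w (i - 1) \<noteq> Matrix.vec_index (0\<^sub>v n) (i - 1)" using v(1,2) by (auto simp: w_def)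
    then have "w \<noteq> 0\<^sub>v n" by metis
    moreover have "A *\<^sub>v w = lam \<cdot>\<^sub>v w"
    proof (rule Matrix.eq_vecI)
      fix k assume "k < dim_vec (lam \<cdot>\<^sub>v w)"
      then have k: "k < n" by (simp add: w_def)
      have "(\<Sum>j\<in>{0..<n}. M (Suc k) (Suc j) * v (Suc j)) = (\<Sum>j\<in>{1..n}. M (Suc k) j * v j)"
        by (rule sum.reindex_bij_witness[of _ "\<lambda>j. j - 1" Suc]) auto
      then show "Matrix.vec_index (A *\<^sub>v w) k = Matrix.vec_index (lam \<cdot>\<^sub>v w) k"
        using k v(3) by (simp add: A_def w_def scalar_prod_def)
    qed (auto simp: A_def w_def)
    ultimately have "eigenvector A w lam" using A by (auto simp: eigenvector_def w_def)
    then show "lam \<in> spectrum A" by (auto simp: spectrum_def eigenvalue_def)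
  qed
  then show ?thesis using card_finite_spectrum(1)[OF A] finite_subset by blast
qed

subsection \<open>The scaled Riccati solution and its spectral bounds\<close>

lemma mmul_assoc: "mmul n (mmul n A B) C = mmul n A (mmul n B C)"
proof (intro ext)
  fix i j
  have "mmul n (mmul n A B) C i j = (\<Sum>k\<in>{1..n}. \<Sum>l\<in>{1..n}. A i l * B l k * C k j)"
    by (simp add: mmul_def sum_distrib_right)
  also have "\<dots> = mmul n A (mmul n B C) i j"
    by (subst sum.swap) (simp add: mmul_def sum_distrib_left mult.assoc)
  finally show "mmul n (mmul n A B) C i j = mmul n A (mmul n B C) i j" .
qed

lemma mmul_identity_right:
  assumes "\<And>k. k \<in> {1..n} \<Longrightarrow> I k j = (if k = j then 1 else 0)" "j \<in> {1..n}"
  shows "mmul n M I i j = M i j"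
proof -
  have "mmul n M I i j = (\<Sum>k\<in>{1..n}. if k = j then M i k else 0)"
    unfolding mmul_def using assms(1) by (intro sum.cong) auto
  then show ?thesis using assms(2) by (simp add: sum.delta)
qed

lemma mmul_identity_left:
  assumes "\<And>k. k \<in> {1..n} \<Longrightarrow> I i k = (if i = k then 1 else 0)" "i \<in> {1..n}"
  shows "mmul n I M i j = M i j"
proof -
  have "mmul n I M i j = (\<Sum>k\<in>{1..n}. if k = i then M k j else 0)"
    unfolding mmul_def using assms(1) by (intro sum.cong) auto
  then show ?thesis using assms(2) by (simp add: sum.delta)
qed

lemma mat_on_eqI:
  assumes "mat_on n M" "mat_on n N" "\<And>i j. i \<in> {1..n} \<Longrightarrow> j \<in> {1..n} \<Longrightarrow> M i j = N i j"
  shows "M = N"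
proof (intro ext)
  fix i j show "M i j = N i j" using assms unfolding mat_on_def by metis
qed

lemma mmul_inverse_unique:
  assumes "mat_on n X" "mat_on n Z"
    and XY: "\<And>i j. i \<in> {1..n} \<Longrightarrow> j \<in> {1..n} \<Longrightarrow> mmul n X Y i j = (if i = j then 1 else 0)"
    and YZ: "\<And>i j. i \<in> {1..n} \<Longrightarrow> j \<in> {1..n} \<Longrightarrow> mmul n Y Z i j = (if i = j then 1 else 0)"
  shows "X = Z"
proof (rule mat_on_eqI[OF assms(1,2)])
  fix i j assume ij: "i \<in> {1..n}" "j \<in> {1..n}"
  have "X i j = mmul n X (mmul n Y Z) i j" using mmul_identity_right[of n "mmul n Y Z" j X i] YZ ij by auto
  also have "\<dots> = mmul n (mmul n X Y) Z i j" by (simp add: mmul_assoc)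
  also have "\<dots> = Z i j" using mmul_identity_left[of n "mmul n X Y" i Z j] XY ij by auto
  finally show "X i j = Z i j" .
qed

lemma minv_Pbin: "minv n (Pbin n) = Qbin n"
  unfolding minv_def
proof (rule the_equality)
  show "mat_on n (Qbin n) \<and> (\<forall>i\<in>{1..n}. \<forall>j\<in>{1..n}.
      mmul n (Pbin n) (Qbin n) i j = (if i = j then 1 else 0) \<and>
      mmul n (Qbin n) (Pbin n) i j = (if i = j then 1 else 0))"
    using mat_on_Qbin Pbin_Qbin by blast
next
  fix Q assume "mat_on n Q \<and> (\<forall>i\<in>{1..n}. \<forall>j\<in>{1..n}.
      mmul n (Pbin n) Q i j = (if i = j then 1 else 0) \<and>
      mmul n Q (Pbin n) i j = (if i = j then 1 else 0))"
  then show "Q = Qbin n"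
    using Pbin_Qbin(1) by (intro mmul_inverse_unique[of n Q "Qbin n" "Pbin n"] mat_on_Qbin) blast+
qed

lemma mv_Qbin_Pbin:
  assumes "i \<in> {1..n}"
  shows "mv n (Qbin n) (mv n (Pbin n) v) i = v i"
proof -
  have "mv n (Qbin n) (mv n (Pbin n) v) i = (\<Sum>k\<in>{1..n}. if k = i then v k else 0)"
    unfolding mv_mv unfolding mv_def using Pbin_Qbin(2)[OF assms] by (intro sum.cong) auto
  then show ?thesis using assms by (simp add: sum.delta)
qed

lemma dot_Pbin: "dot n v (mv n (Pbin n) w) = dot n (mv n (Lbin n) v) (mv n (Lbin n) w)"
proof -
  have "mv n (Pbin n) w i = mv n (mtr (Lbin n)) (mv n (Lbin n) w) i" if "i \<in> {1..n}" for i
    unfolding mv_mv using that by (auto simp: mv_def mmul_def mtr_def Pbin_def intro!: sum.cong)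
  then have "dot n v (mv n (Pbin n) w) = dot n v (mv n (mtr (Lbin n)) (mv n (Lbin n) w))"
    by (intro dot_cong) auto
  then show ?thesis by (simp add: dot_mv_transpose[of n v] mtr_def)
qed

lemma dot_Pbin_nonneg: "dot n v (mv n (Pbin n) v) \<ge> 0"
  by (simp add: dot_Pbin dot_self_nonneg)

lemma posdef_Pbin: "posdef n (Pbin n)"
  unfolding posdef_iff
proof (intro conjI allI impI ballI)
  show "Pbin n i j = Pbin n j i" for i j by (rule Pbin_sym)
  fix v :: "nat \<Rightarrow> real" assume v: "\<exists>i\<in>{1..n}. v i \<noteq> 0"
  have "\<exists>k\<in>{1..n}. mv n (Lbin n) v k \<noteq> 0"
  proof (rule ccontr)
    assume "\<not> ?thesis"
    then have 0: "dot n u (mv n (Pbin n) v) = 0" for u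
      unfolding dot_Pbin by (auto simp: dot_def intro!: sum.neutral)
    have "mv n (Pbin n) v i = 0" if "i \<in> {1..n}" for i
      using dot_unit[OF that, of "mv n (Pbin n) v"] 0 by simp
    then have "mv n (Qbin n) (mv n (Pbin n) v) i = 0" for i
      by (auto simp: mv_def[of n "Qbin n"])
    then show False using mv_Qbin_Pbin v by metis
  qed
  then show "dot n v (mv n (Pbin n) v) > 0" unfolding dot_Pbin by (rule dot_self_pos)
qed

definition Pscaled :: "nat \<Rightarrow> real \<Rightarrow> nat \<Rightarrow> nat \<Rightarrow> real" where
  "Pscaled n g i j = g * g ^ (n - i) * g ^ (n - j) * Pbin n i j"

lemma riccati_sol_Pscaled:
  assumes "n \<ge> 1" "g > 0"
  shows "riccati_sol n g (Pscaled n g)"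
  unfolding riccati_sol_entries[OF assms(1)]
proof (intro conjI ballI)
  show "mat_on n (Pscaled n g)" by (auto simp: mat_on_def Pscaled_def Pbin_def)
  show "posdef n (Pscaled n g)"
    unfolding posdef_iff
  proof (intro conjI allI impI ballI)
    show "Pscaled n g i j = Pscaled n g j i" for i j by (simp add: Pscaled_def Pbin_sym[of n i j])
    fix v :: "nat \<Rightarrow> real" assume v: "\<exists>i\<in>{1..n}. v i \<noteq> 0"
    define z where "z i = g ^ (n - i) * v i" for i
    have "dot n v (mv n (Pscaled n g) v) = g * dot n z (mv n (Pbin n) z)"
      by (simp add: dot_def mv_def z_def Pscaled_def sum_distrib_left mult_ac)
    moreover have "\<exists>i\<in>{1..n}. z i \<noteq> 0" using v assms(2) by (auto simp: z_def)
    ultimately show "dot n v (mv n (Pscaled n g) v) > 0"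
      using posdef_Pbin[of n] assms(2) unfolding posdef_iff by simp
  qed
  fix i j assume ij: "i \<in> {1..n}" "j \<in> {1..n}"
  have e: "n - (i - 1) = Suc (n - i)" "n - (j - 1) = Suc (n - j)" using ij by auto
  have "Pscaled n g (i - 1) j + Pscaled n g i (j - 1) - Pscaled n g i n * Pscaled n g n j
    = g * g * g ^ (n - i) * g ^ (n - j) *
      (Pbin n (i - 1) j + Pbin n i (j - 1) - Pbin n i n * Pbin n n j)"
    unfolding Pscaled_def e by (simp add: algebra_simps)
  then show "Pscaled n g (i - 1) j + Pscaled n g i (j - 1) - Pscaled n g i n * Pscaled n g n j
      = - g * Pscaled n g i j"
    unfolding Pbin_riccati[OF ij] by (simp add: Pscaled_def)
qed

lemma riccati_sol_unique:
  assumes n: "n \<ge> 1" and g: "g > 0" and P: "riccati_sol n g P"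
  shows "P = Pscaled n g"
proof -
  have on: "mat_on n P" and pd: "posdef n P" and
    ric: "\<And>i j. i \<in> {1..n} \<Longrightarrow> j \<in> {1..n} \<Longrightarrow>
      P (i - 1) j + P i (j - 1) - P i n * P n j = - g * P i j"
    using P unfolding riccati_sol_entries[OF n] by blast+
  have "P 1 1 > 0"
  proof -
    let ?e = "\<lambda>k. if k = 1 then 1 else 0 :: real"
    have "dot n ?e (mv n P ?e) > 0" using pd n unfolding posdef_iff by auto
    then show ?thesis using n dot_unit[of 1 n] mv_unit[of 1 n P] by simp
  qed
  then have P1n: "P 1 n \<noteq> 0"
    using ric[of 1 1] n g mat_on_zero[OF on, of 0 1] mat_on_zero[OF on, of 1 0] by auto
  define R where "R i j = P i j / (g * g ^ (n - i) * g ^ (n - j))" for i j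
  have R: "mat_on n R" using on by (simp add: mat_on_def R_def)
  have "mmul n R (Qbin n) i j = (if i = j then 1 else 0)" if "i \<in> {1..n}" "j \<in> {1..n}" for i j
  proof (rule Qbin_right_inverse[OF R _ _ that])
    show "R 1 n \<noteq> 0" using P1n g by (simp add: R_def)
    fix i j assume ij: "i \<in> {1..n}" "j \<in> {1..n}"
    have e: "n - (i - 1) = Suc (n - i)" "n - (j - 1) = Suc (n - j)" using ij by auto
    have "R (i - 1) j + R i (j - 1) - R i n * R n j
      = (P (i - 1) j + P i (j - 1) - P i n * P n j) / (g * g * g ^ (n - i) * g ^ (n - j))"
      unfolding R_def e using g by (simp add: field_simps)
    then show "R (i - 1) j + R i (j - 1) - R i n * R n j = - R i j"
      unfolding ric[OF ij] using g by (simp add: R_def)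
  qed
  then have "R = Pbin n"
    using Pbin_Qbin(2) by (intro mmul_inverse_unique[of n R "Pbin n" "Qbin n"] R mat_on_Pbin) auto
  moreover have "P i j = g * g ^ (n - i) * g ^ (n - j) * R i j" for i j
    using g by (simp add: R_def)
  ultimately show ?thesis by (intro ext) (simp add: Pscaled_def)
qed

lemma Pmat_eq:
  assumes "n \<ge> 1" "g > 0"
  shows "Pmat n g = Pscaled n g"
  unfolding Pmat_def using riccati_sol_Pscaled[OF assms] riccati_sol_unique[OF assms] by (rule the_equality)

lemma Pmat_1: "n \<ge> 1 \<Longrightarrow> Pmat n 1 = Pbin n"
  by (intro ext) (simp add: Pmat_eq Pscaled_def)

lemma eigvalsI:
  assumes "\<exists>i\<in>{1..n}. v i \<noteq> 0" "\<And>i. i \<in> {1..n} \<Longrightarrow> mv n M v i = lam * v i"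
  shows "lam \<in> eigvals n M"
  using assms unfolding eigvals_def mv_def by blast

lemma dot_Pbin_le_Lambda:
  assumes n: "n \<ge> 1"
  shows "dot n y (mv n (Pbin n) y) \<le> Lambda n * dot n y y"
proof -
  define I where "I i j = (if i = j then 1 else 0 :: real)" for i j :: nat
  have I: "mv n I v i = v i" if "i \<in> {1..n}" for v i
  proof -
    have "mv n I v i = (\<Sum>j\<in>{1..n}. if j = i then v j else 0)"
      unfolding mv_def I_def by (intro sum.cong) auto
    then show ?thesis using that by (simp add: sum.delta)
  qed
  then have Idot: "dot n v (mv n I v) = dot n v v" for v by (intro dot_cong) auto
  have "posdef n I" unfolding posdef_iff Idot by (auto simp: I_def dot_self_pos)
  obtain lam v where v: "\<exists>i\<in>{1..n}. v i \<noteq> 0"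
    "\<And>i. i \<in> {1..n} \<Longrightarrow> mv n (Pbin n) v i = lam * mv n I v i"
    "\<And>y. dot n y (mv n (Pbin n) y) \<le> lam * dot n y (mv n I y)"
    by (rule Rayleigh_quotient_max[of n "Pbin n" I, OF n Pbin_sym \<open>posdef n I\<close>]) (rule that)
  then have "lam \<in> eigvals n (Pbin n)" using I by (intro eigvalsI[of n v]) simp_all
  then have "lam \<le> Lambda n"
    unfolding Lambda_def lam_max_def Pmat_1[OF n] using finite_eigvals by (intro Max_ge) auto
  then show ?thesis
    using v(3)[of y] mult_right_mono[OF _ dot_self_nonneg, of lam "Lambda n" n y] by (simp add: Idot)
qed

lemma Lambda_pos:
  assumes "n \<ge> 1"
  shows "Lambda n > 0"
proof -
  have 1: "1 \<in> {1..n}" using assms by simp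
  let ?e = "\<lambda>k. if k = 1 then 1 else 0 :: real"
  have "0 < dot n ?e (mv n (Pbin n) ?e)" using posdef_Pbin[of n] assms unfolding posdef_iff by auto
  also have "\<dots> \<le> Lambda n * dot n ?e ?e" by (rule dot_Pbin_le_Lambda[OF assms])
  also have "dot n ?e ?e = 1" unfolding dot_unit[OF 1] by simp
  finally show ?thesis by simp
qed

lemma Qbin_factor:
  assumes "i \<in> {1..n}" "j \<in> {1..n}"
  shows "Qbin n i j = (-1) ^ (i + j) * (\<Sum>k\<in>{1..n}. Lbin n i k * Lbin n j k)"
proof -
  define p q where "p = n - i" and "q = n - j"
  have "(\<Sum>k\<in>{1..n}. real (p choose (n - k)) * real (q choose (n - k)))
      = (\<Sum>m<n. real (p choose m) * real (q choose m))"
    by (rule sum.reindex_bij_witness[of _ "\<lambda>m. n - m" "\<lambda>k. n - k"]) auto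
  also have "\<dots> = (\<Sum>m\<le>p. real (p choose m) * real (q choose m))"
    using assms by (intro sum.mono_neutral_right) (auto simp: p_def)
  also have "\<dots> = (\<Sum>m\<le>p. real ((q choose m) * (p choose (p - m))))"
  proof (intro sum.cong refl)
    fix m assume "m \<in> {..p}"
    then have "p choose (p - m) = p choose m" using binomial_symmetric[of m p] by (metis atMost_iff)
    then show "real (p choose m) * real (q choose m) = real ((q choose m) * (p choose (p - m)))" by simp
  qed
  also have "\<dots> = real ((q + p) choose p)"
    by (simp only: vandermonde flip: of_nat_sum)
  finally show ?thesis using assms by (simp add: Qbin_def Lbin_def p_def q_def add.commute)
qed

text \<open>\<open>Qbin\<close> is conjugate, by a diagonal sign matrix, to \<open>L L\<^sup>T\<close>, whereas \<open>Pbin = L\<^sup>T L\<close>: hence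
  \<open>P\<^sub>n\<^sup>-\<^sup>1\<close> has the spectrum of \<open>P\<^sub>n\<close>, and the least eigenvalue of \<open>P\<^sub>n\<close> is the reciprocal of the
  largest one.\<close>

lemma dot_self_le_Lambda_Pbin:
  assumes n: "n \<ge> 1"
  shows "dot n w w \<le> Lambda n * dot n w (mv n (Pbin n) w)"
proof -
  define a where "a = mv n (Pbin n) w"
  define z where "z i = (-1) ^ i * a i" for i
  define y where "y = mv n (mtr (Lbin n)) z"
  have w: "w i = (-1) ^ i * mv n (Lbin n) y i" if i: "i \<in> {1..n}" for i
  proof -
    have "w i = mv n (Qbin n) a i" by (simp add: a_def mv_Qbin_Pbin[OF i])
    also have "\<dots> = (\<Sum>j\<in>{1..n}. (-1) ^ i * (mmul n (Lbin n) (mtr (Lbin n)) i j * z j))"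
      unfolding mv_def using Qbin_factor[OF i]
      by (intro sum.cong) (auto simp: mmul_def mtr_def z_def power_add)
    also have "\<dots> = (-1) ^ i * mv n (Lbin n) y i"
      unfolding y_def mv_mv by (simp add: mv_def sum_distrib_left)
    finally show ?thesis .
  qed
  have sq: "(-1) ^ i * ((-1) ^ i * x) = (x :: real)" for i :: nat and x
    by (simp add: mult.assoc[symmetric] flip: power_add)
  have "dot n w w = dot n (mv n (Lbin n) y) (mv n (Lbin n) y)"
    unfolding dot_def using w by (intro sum.cong) (auto simp: mult_ac sq)
  also have "\<dots> \<le> Lambda n * dot n y y"
    using dot_Pbin_le_Lambda[OF n] by (simp add: dot_Pbin)
  also have "dot n y y = dot n z (mv n (Lbin n) y)"
    by (simp add: dot_mv_transpose[of n z] y_def)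
  also have "\<dots> = dot n w a"
    unfolding dot_def using w by (intro sum.cong) (auto simp: z_def mult_ac)
  finally show ?thesis by (simp add: a_def)
qed

lemma delta_c_bounds:
  assumes n: "n \<ge> 1"
  obtains lam where "lam \<ge> 0" "delta_c n = real n * (1 + lam)"
    "\<And>y. 2 * dot n (\<lambda>i. real (n - i) * y i) (mv n (Pbin n) y) \<le> lam * dot n y (mv n (Pbin n) y)"
proof -
  define S where "S i j = real (n - i) * Pbin n i j + Pbin n i j * real (n - j)" for i j
  define M where "M = (\<lambda>i j. Emat n i j + mmul n (mmul n (Pbin n) (Emat n)) (Qbin n) i j)"
  have Smv: "mv n S y i = real (n - i) * mv n (Pbin n) y i + mv n (Pbin n) (\<lambda>i. real (n - i) * y i) i" for y i
    by (simp add: mv_def S_def distrib_right sum.distrib sum_distrib_left mult.assoc)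
  have Sdot: "dot n y (mv n S y) = 2 * dot n (\<lambda>i. real (n - i) * y i) (mv n (Pbin n) y)" for y
  proof -
    have "dot n y (mv n S y) = dot n (\<lambda>i. real (n - i) * y i) (mv n (Pbin n) y)
        + dot n y (mv n (Pbin n) (\<lambda>i. real (n - i) * y i))"
      unfolding Smv dot_add_right by (simp add: dot_def mult_ac)
    also have "dot n y (mv n (Pbin n) (\<lambda>i. real (n - i) * y i))
        = dot n (\<lambda>i. real (n - i) * y i) (mv n (Pbin n) y)"
      by (rule dot_mv_sym) (rule Pbin_sym)
    finally show ?thesis by simp
  qed
  obtain lam v where v: "\<exists>i\<in>{1..n}. v i \<noteq> 0"
    "\<And>i. i \<in> {1..n} \<Longrightarrow> mv n S v i = lam * mv n (Pbin n) v i"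
    "\<And>y. dot n y (mv n S y) \<le> lam * dot n y (mv n (Pbin n) y)"
  proof (rule Rayleigh_quotient_max[of n S "Pbin n", OF n _ posdef_Pbin])
    show "S i j = S j i" for i j by (simp add: S_def Pbin_sym[of n i j])
  qed (rule that)
  define u where "u = mv n (Pbin n) v"
  have Emv: "mv n (Emat n) w i = real (n - i) * w i" if "i \<in> {1..n}" for w i
  proof -
    have "mv n (Emat n) w i = (\<Sum>j\<in>{1..n}. if j = i then real (n - i) * w j else 0)"
      unfolding mv_def Emat_def using that by (intro sum.cong) auto
    then show ?thesis using that by (simp add: sum.delta)
  qed
  have "\<exists>i\<in>{1..n}. u i \<noteq> 0"
  proof (rule ccontr)
    assume "\<not> ?thesis"
    then have "mv n (Qbin n) u i = 0" for i by (auto simp: mv_def)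
    then show False using v(1) mv_Qbin_Pbin unfolding u_def by metis
  qed
  moreover have "mv n M u i = lam * u i" if i: "i \<in> {1..n}" for i
  proof -
    have "mv n M u i = mv n (Emat n) u i + mv n (mmul n (mmul n (Pbin n) (Emat n)) (Qbin n)) u i"
      by (simp add: M_def mv_def distrib_right sum.distrib)
    also have "mv n (mmul n (mmul n (Pbin n) (Emat n)) (Qbin n)) u
        = mv n (Pbin n) (mv n (Emat n) (mv n (Qbin n) u))"
      by (simp add: mv_mv mmul_assoc)
    also have "\<dots> = mv n (Pbin n) (\<lambda>i. real (n - i) * v i)"
    proof (rule mv_cong)
      fix j assume j: "j \<in> {1..n}"
      show "mv n (Emat n) (mv n (Qbin n) u) j = real (n - j) * v j"
        by (simp add: Emv[OF j] u_def mv_Qbin_Pbin[OF j])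
    qed
    finally show ?thesis using v(2)[OF i] Emv[OF i] by (simp add: Smv u_def)
  qed
  ultimately have "lam \<in> eigvals n M" by (rule eigvalsI)
  then have lam: "lam \<le> lam_max n M"
    unfolding lam_max_def using finite_eigvals by (intro Max_ge) auto
  have bound: "2 * dot n (\<lambda>i. real (n - i) * y i) (mv n (Pbin n) y)
      \<le> lam_max n M * dot n y (mv n (Pbin n) y)" for y
    using v(3)[of y] mult_right_mono[OF lam dot_Pbin_nonneg[of n y]] by (simp add: Sdot)
  moreover have "lam_max n M \<ge> 0"
  proof -
    let ?e = "\<lambda>k. if k = 1 then 1 else 0 :: real"
    have 1: "1 \<in> {1..n}" using n by simp
    have "dot n (\<lambda>i. real (n - i) * ?e i) w = real (n - 1) * w 1" for w
    proof -
      have "(\<lambda>i. real (n - i) * ?e i) = (\<lambda>i. real (n - 1) * ?e i)" by auto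
      then show ?thesis using dot_unit[OF 1, of w] by (simp only: dot_scale_left)
    qed
    then have "2 * (real (n - 1) * Pbin n 1 1) \<le> lam_max n M * Pbin n 1 1"
      using bound[of ?e] by (simp only: dot_unit[OF 1] mv_unit[OF 1])
    moreover have "0 < Pbin n 1 1"
      using posdef_Pbin[of n] n dot_unit[OF 1] mv_unit[OF 1, of "Pbin n"] unfolding posdef_iff
      by (metis (mono_tags, lifting) 1 zero_neq_one)
    ultimately have "2 * real (n - 1) \<le> lam_max n M" by simp
    then show ?thesis by linarith
  qed
  moreover have "delta_c n = real n * (1 + lam_max n M)"
    unfolding delta_c_def Pmat_1[OF n] minv_Pbin M_def by simp
  ultimately show ?thesis using that by blast
qed

subsection \<open>The Lyapunov inequality\<close>

lemma Pbin_shift: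
  assumes n: "n \<ge> 1"
  shows "2 * dot n (\<lambda>i. if i < n then w (Suc i) else 0) (mv n (Pbin n) w)
    = (mv n (Pbin n) w n)\<^sup>2 - dot n w (mv n (Pbin n) w)"
proof -
  let ?P = "Pbin n"
  have P0: "?P 0 j = 0" for j by (simp add: Pbin_def)
  have "dot n (\<lambda>i. if i < n then w (Suc i) else 0) (mv n ?P w) = (\<Sum>i\<in>{1..<n}. w (Suc i) * mv n ?P w i)"
    unfolding dot_def by (rule sum.mono_neutral_cong_right) auto
  also have "\<dots> = (\<Sum>i\<in>{2..n}. w i * mv n ?P w (i - 1))"
    by (rule sum.reindex_bij_witness[of _ "\<lambda>i. i - 1" Suc]) auto
  also have "\<dots> = (\<Sum>i\<in>{1..n}. w i * mv n ?P w (i - 1))"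
    by (rule sum.mono_neutral_left) (auto simp: mv_def P0 not_le less_Suc_eq numeral_2_eq_2)
  also have "\<dots> = (\<Sum>i\<in>{1..n}. \<Sum>j\<in>{1..n}. w i * ?P (i - 1) j * w j)" (is "_ = ?A")
    by (simp add: mv_def sum_distrib_left mult.assoc)
  finally have 1: "dot n (\<lambda>i. if i < n then w (Suc i) else 0) (mv n ?P w) = ?A" .
  have 2: "?A = (\<Sum>i\<in>{1..n}. \<Sum>j\<in>{1..n}. w i * ?P i (j - 1) * w j)"
  proof (subst sum.swap, intro sum.cong refl)
    fix i j
    show "w j * ?P (j - 1) i * w i = w i * ?P i (j - 1) * w j"
      unfolding Pbin_sym[of n "j - 1" i] by (simp only: mult_ac)
  qed
  have "2 * ?A = (\<Sum>i\<in>{1..n}. \<Sum>j\<in>{1..n}. w i * (?P (i - 1) j + ?P i (j - 1)) * w j)"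
    unfolding mult_2 by (subst (2) 2) (simp add: distrib_left distrib_right sum.distrib)
  also have "\<dots> = (\<Sum>i\<in>{1..n}. \<Sum>j\<in>{1..n}. (?P n i * w i) * (?P n j * w j) - w i * ?P i j * w j)"
  proof (intro sum.cong refl)
    fix i j assume ij: "i \<in> {1..n}" "j \<in> {1..n}"
    have *: "?P (i - 1) j + ?P i (j - 1) = ?P n i * ?P n j - ?P i j"
      using Pbin_riccati[OF ij] Pbin_sym[of n i n] by simp
    show "w i * (?P (i - 1) j + ?P i (j - 1)) * w j = (?P n i * w i) * (?P n j * w j) - w i * ?P i j * w j"
      unfolding * by (simp add: algebra_simps)
  qed
  also have "\<dots> = (mv n ?P w n)\<^sup>2 - dot n w (mv n ?P w)"
    unfolding power2_eq_square dot_def mv_def sum_product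
    by (simp add: sum_subtractf sum_distrib_left mult.assoc)
  finally show ?thesis unfolding 1 .
qed

lemma Pbin_last_row_bound:
  assumes n: "n \<ge> 1"
  shows "(mv n (Pbin n) w n)\<^sup>2 \<le> real n * dot n w (mv n (Pbin n) w)"
proof -
  have nn: "n \<in> {1..n}" using n by simp
  let ?e = "\<lambda>k. if k = n then 1 else 0 :: real"
  have "(mv n (Pbin n) w n)\<^sup>2 = (dot n (mv n (Lbin n) ?e) (mv n (Lbin n) w))\<^sup>2"
    using dot_unit[OF nn] by (simp flip: dot_Pbin)
  also have "\<dots> \<le> dot n ?e (mv n (Pbin n) ?e) * dot n w (mv n (Pbin n) w)"
    unfolding dot_Pbin by (rule Cauchy_Schwarz_dot)
  also have "dot n ?e (mv n (Pbin n) ?e) = real n"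
    using dot_unit[OF nn] mv_unit[OF nn, of "Pbin n"] Pbin_last_row[OF nn] by simp
  finally show ?thesis .
qed

lemma Pbin_cross_bound:
  assumes n: "n \<ge> 1" and K: "K \<ge> 0" and psi: "dot n \<psi> \<psi> \<le> K\<^sup>2 * dot n w w"
  shows "dot n \<psi> (mv n (Pbin n) w) \<le> Lambda n * K * dot n w (mv n (Pbin n) w)"
proof -
  let ?W = "dot n w (mv n (Pbin n) w)"
  note W = dot_Pbin_nonneg[of n w] and Lam = Lambda_pos[OF n]
  have "(dot n \<psi> (mv n (Pbin n) w))\<^sup>2 \<le> dot n \<psi> (mv n (Pbin n) \<psi>) * ?W"
    unfolding dot_Pbin by (rule Cauchy_Schwarz_dot)
  also have "\<dots> \<le> (Lambda n * (K\<^sup>2 * (Lambda n * ?W))) * ?W"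
  proof (rule mult_right_mono[OF _ W])
    have "dot n \<psi> (mv n (Pbin n) \<psi>) \<le> Lambda n * dot n \<psi> \<psi>" by (rule dot_Pbin_le_Lambda[OF n])
    also have "\<dots> \<le> Lambda n * (K\<^sup>2 * dot n w w)" using psi Lam by (intro mult_left_mono) auto
    also have "\<dots> \<le> Lambda n * (K\<^sup>2 * (Lambda n * ?W))"
      using Lam dot_self_le_Lambda_Pbin[OF n] by (intro mult_left_mono) auto
    finally show "dot n \<psi> (mv n (Pbin n) \<psi>) \<le> Lambda n * (K\<^sup>2 * (Lambda n * ?W))" .
  qed
  also have "\<dots> = (Lambda n * K * ?W)\<^sup>2" by (simp add: power2_eq_square mult_ac)
  finally show ?thesis by (rule power2_le_imp_le) (use Lam K W in simp)
qed

lemma dconst_nonneg: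
  assumes "n \<ge> 1"
  shows "dconst n c T \<ge> 0"
    and "j \<in> {1..n} \<Longrightarrow> (\<Sum>i\<in>{j..n}. (gcoef n c T i j)\<^sup>2 * real i * inverse ((1 / T) ^ (2 * (i - j))))
      \<le> (dconst n c T)\<^sup>2"
proof -
  define f where "f j = (\<Sum>i\<in>{j..n}. (gcoef n c T i j)\<^sup>2 * real i * inverse ((1 / T) ^ (2 * (i - j))))" for j
  have f0: "f j \<ge> 0" for j unfolding f_def by (intro sum_nonneg) (auto simp: power_mult)
  have le: "f j \<le> Max (f ` {1..n})" if "j \<in> {1..n}" for j using that by auto
  then have "f 1 \<le> Max (f ` {1..n})" using assms by simp
  then have "Max (f ` {1..n}) \<ge> 0" using f0[of 1] by (rule order_trans[rotated])
  then show "dconst n c T \<ge> 0" and "j \<in> {1..n} \<Longrightarrow> f j \<le> (dconst n c T)\<^sup>2"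
    using le by (auto simp: dconst_def f_def[symmetric])
qed

lemma perturbation_bound:
  assumes n: "n \<ge> 1" and r: "0 < r" "r \<le> T"
    and c: "\<And>i j. 1 \<le> j \<Longrightarrow> j \<le> i \<Longrightarrow> i \<le> n \<Longrightarrow> c i j \<ge> 0"
    and psi: "\<And>i. i \<in> {1..n} \<Longrightarrow>
      \<bar>\<psi> i\<bar> \<le> real (n - i) / r * \<bar>w i\<bar> + (\<Sum>j\<in>{1..i}. c i j * r ^ (2 * (i - j)) * \<bar>w j\<bar>)"
  shows "dot n \<psi> \<psi> \<le> (dconst n c T / r)\<^sup>2 * dot n w w"
proof -
  have T: "T > 0" using r by simp
  define G where "G i j = gcoef n c T i j * T ^ (i - j)" for i j
  have row: "(r * \<psi> i)\<^sup>2 \<le> (\<Sum>j\<in>{1..n}. if j \<le> i then real i * (G i j * w j)\<^sup>2 else 0)" if i: "i \<in> {1..n}" for i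
  proof -
    have diag: "c i i * r ^ (2 * (i - i)) * \<bar>w i\<bar> = (c i i * 1) * \<bar>w i\<bar>" by simp
    have "r * \<bar>\<psi> i\<bar> \<le> r * (real (n - i) / r * \<bar>w i\<bar> + (\<Sum>j\<in>{1..i}. c i j * r ^ (2 * (i - j)) * \<bar>w j\<bar>))"
      using psi[OF i] r by (intro mult_left_mono) auto
    also have "\<dots> = real (n - i) * \<bar>w i\<bar> + (\<Sum>j\<in>{1..i}. r * r ^ (2 * (i - j)) * c i j * \<bar>w j\<bar>)"
      using r by (simp add: distrib_left sum_distrib_left mult_ac)
    also have "{1..i} = insert i {1..<i}" using i by auto
    also have "real (n - i) * \<bar>w i\<bar> + (\<Sum>j\<in>insert i {1..<i}. r * r ^ (2 * (i - j)) * c i j * \<bar>w j\<bar>)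
        = (r * c i i + real (n - i)) * \<bar>w i\<bar> + (\<Sum>j\<in>{1..<i}. r * r ^ (2 * (i - j)) * c i j * \<bar>w j\<bar>)"
      by (simp add: algebra_simps)
    also have "\<dots> \<le> G i i * \<bar>w i\<bar> + (\<Sum>j\<in>{1..<i}. G i j * \<bar>w j\<bar>)"
    proof (intro add_mono sum_mono mult_right_mono)
      show "r * c i i + real (n - i) \<le> G i i"
        using r i c[of i i] by (simp add: G_def gcoef_def mult.commute mult_right_mono)
      fix j assume j: "j \<in> {1..<i}"
      have "r * r ^ (2 * (i - j)) \<le> T * T ^ (2 * (i - j))"
        using r by (intro mult_mono power_mono) auto
      then have "r * r ^ (2 * (i - j)) * c i j \<le> T * T ^ (2 * (i - j)) * c i j"
        using c[of j i] i j by (intro mult_right_mono) auto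
      also have "\<dots> = G i j"
      proof -
        have "i + 1 - j = Suc (i - j)" using j by auto
        then show ?thesis using j by (simp add: G_def gcoef_def power_mult power2_eq_square power_mult_distrib)
      qed
      finally show "r * r ^ (2 * (i - j)) * c i j \<le> G i j" .
    qed auto
    also have "\<dots> = (\<Sum>j\<in>insert i {1..<i}. G i j * \<bar>w j\<bar>)" by simp
    also have "insert i {1..<i} = {1..i}" using i by auto
    finally have "r * \<bar>\<psi> i\<bar> \<le> (\<Sum>j\<in>{1..i}. G i j * \<bar>w j\<bar>)" .
    moreover have "(r * \<psi> i)\<^sup>2 = (r * \<bar>\<psi> i\<bar>)\<^sup>2" by (simp add: power_mult_distrib)
    ultimately have "(r * \<psi> i)\<^sup>2 \<le> (\<Sum>j\<in>{1..i}. 1 * (G i j * \<bar>w j\<bar>))\<^sup>2"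
      using r by (simp add: power_mono)
    also have "\<dots> \<le> (\<Sum>j\<in>{1..i}. 1\<^sup>2) * (\<Sum>j\<in>{1..i}. (G i j * \<bar>w j\<bar>)\<^sup>2)"
      by (rule Cauchy_Schwarz_ineq_sum)
    also have "\<dots> = (\<Sum>j\<in>{1..i}. real i * (G i j * w j)\<^sup>2)"
      by (simp add: sum_distrib_left power_mult_distrib)
    also have "\<dots> = (\<Sum>j\<in>{1..n}. if j \<le> i then real i * (G i j * w j)\<^sup>2 else 0)"
      using i by (intro sum.mono_neutral_cong_left) auto
    finally show ?thesis .
  qed
  have "r\<^sup>2 * dot n \<psi> \<psi> = (\<Sum>i\<in>{1..n}. (r * \<psi> i)\<^sup>2)"
    by (simp add: dot_def sum_distrib_left power2_eq_square mult_ac)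
  also have "\<dots> \<le> (\<Sum>i\<in>{1..n}. \<Sum>j\<in>{1..n}. if j \<le> i then real i * (G i j * w j)\<^sup>2 else 0)"
    by (rule sum_mono) (rule row)
  also have "\<dots> = (\<Sum>j\<in>{1..n}. \<Sum>i\<in>{1..n}. if j \<le> i then real i * (G i j * w j)\<^sup>2 else 0)"
    by (rule sum.swap)
  also have "\<dots> = (\<Sum>j\<in>{1..n}. (\<Sum>i\<in>{j..n}. (gcoef n c T i j)\<^sup>2 * real i * inverse ((1 / T) ^ (2 * (i - j)))) * (w j * w j))"
  proof (rule sum.cong[OF refl])
    fix j assume j: "j \<in> {1..n}"
    have "(\<Sum>i\<in>{1..n}. if j \<le> i then real i * (G i j * w j)\<^sup>2 else 0)
        = (\<Sum>i\<in>{j..n}. real i * (G i j * w j)\<^sup>2)"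
      using j by (intro sum.mono_neutral_cong_right) auto
    also have "\<dots> = (\<Sum>i\<in>{j..n}. (gcoef n c T i j)\<^sup>2 * real i * inverse ((1 / T) ^ (2 * (i - j)))) * (w j * w j)"
      unfolding sum_distrib_right
    proof (rule sum.cong[OF refl])
      fix i
      have "inverse ((1 / T) ^ (2 * (i - j))) = T ^ (i - j) * T ^ (i - j)"
        by (simp add: power_one_over mult_2 power_add)
      then show "real i * (G i j * w j)\<^sup>2 = (gcoef n c T i j)\<^sup>2 * real i * inverse ((1 / T) ^ (2 * (i - j))) * (w j * w j)"
        by (simp only: G_def) (simp add: power2_eq_square mult_ac)
    qed
    finally show "(\<Sum>i\<in>{1..n}. if j \<le> i then real i * (G i j * w j)\<^sup>2 else 0) = \<dots>" .
  qed
  also have "\<dots> \<le> (\<Sum>j\<in>{1..n}. (dconst n c T)\<^sup>2 * (w j * w j))"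
    by (intro sum_mono mult_right_mono dconst_nonneg(2)[OF n]) auto
  also have "\<dots> = (dconst n c T)\<^sup>2 * dot n w w" by (simp add: dot_def sum_distrib_left)
  finally show ?thesis using r by (simp add: power_divide field_simps)
qed

lemma beta_gain_eq:
  assumes "n \<ge> 1" "delta_c n = real n * (1 + lam)"
  shows "beta_gain n c T = 3 + lam + 2 * dconst n c T * Lambda n"
  using assms by (simp add: beta_gain_def field_simps)

lemma beta_gain_pos:
  assumes n: "n \<ge> 1"
  shows "beta_gain n c T > 0"
proof -
  obtain lam where "lam \<ge> 0" "delta_c n = real n * (1 + lam)" using delta_c_bounds[OF n] by metis
  then show ?thesis
    using beta_gain_eq[OF n, of lam c T] mult_nonneg_nonneg[OF dconst_nonneg(1)[OF n, of c T], of "Lambda n"]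
      Lambda_pos[OF n] by simp
qed

lemma Lyapunov_rate:
  fixes T :: real
  assumes n: "n \<ge> 1" and r: "0 < r" "r \<le> T"
    and c: "\<And>i j. 1 \<le> j \<Longrightarrow> j \<le> i \<Longrightarrow> i \<le> n \<Longrightarrow> c i j \<ge> 0"
    and w: "\<And>i. i \<in> {1..n} \<Longrightarrow> x i = r ^ (2 * (n - i)) * w i"
    and p: "\<And>i. i \<in> {1..n} \<Longrightarrow> \<bar>p i\<bar> \<le> (\<Sum>j\<in>{1..i}. c i j * \<bar>x j\<bar>)"
    and \<beta>: "\<beta> = beta_gain n c T"
    and v: "v = r * (\<beta> - 3 * r * \<kappa>)"
    and x': "\<And>i. i \<in> {1..<n} \<Longrightarrow> x' i = v * x (i + 1) + p i"
    and xn': "x' n = - (\<beta> / r) * mv n (Pbin n) w n + p n"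
    and w': "\<And>i. i \<in> {1..n} \<Longrightarrow> w' i = real (2 * (n - i)) / r * w i + x' i / r ^ (2 * (n - i))"
  shows "2 * dot n w' (mv n (Pbin n) w)
    \<le> (3 * (real n + 1) * \<bar>\<kappa>\<bar> - 3 / r) * dot n w (mv n (Pbin n) w)"
proof -
  define a where "a = mv n (Pbin n) w"
  define s W where "s = a n" and "W = dot n w a"
  define \<psi> where "\<psi> i = real (n - i) / r * w i + p i / r ^ (2 * (n - i))" for i
  let ?D = "dconst n c T"
  let ?sh = "\<lambda>i. if i < n then w (Suc i) else 0"
  let ?e = "\<lambda>k. if k = n then 1 else 0 :: real"
  obtain lam where lam: "lam \<ge> 0" "delta_c n = real n * (1 + lam)"
    "\<And>y. 2 * dot n (\<lambda>i. real (n - i) * y i) (mv n (Pbin n) y) \<le> lam * dot n y (mv n (Pbin n) y)"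
    using delta_c_bounds[OF n] by blast
  have \<beta>_eq: "\<beta> = 3 + lam + 2 * ?D * Lambda n" unfolding \<beta> by (rule beta_gain_eq[OF n lam(2)])
  have \<beta>_pos: "\<beta> > 0" unfolding \<beta> by (rule beta_gain_pos[OF n])
  have split: "w' i = (\<beta> / r - 3 * \<kappa>) * ?sh i + (- (\<beta> / r) * s) * ?e i
      + 1 / r * (real (n - i) * w i) + \<psi> i" if i: "i \<in> {1..n}" for i
  proof (cases "i = n")
    case True
    then show ?thesis using w'[OF i] xn' by (simp add: \<psi>_def s_def a_def)
  next
    case False
    then have i': "i \<in> {1..<n}" "i < n" and Si: "Suc i \<in> {1..n}" using i by auto
    have e: "2 * (n - i) = Suc (Suc (2 * (n - Suc i)))" using i'(2) by simp
    have "v * x (i + 1) / r ^ (2 * (n - i)) = (\<beta> / r - 3 * \<kappa>) * w (Suc i)"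
      using r w[OF Si] unfolding e v by (simp add: field_simps)
    moreover have "w' i = real (n - i) / r * w i + real (n - i) / r * w i
        + (v * x (i + 1) / r ^ (2 * (n - i)) + p i / r ^ (2 * (n - i)))"
      unfolding w'[OF i] x'[OF i'(1)] by (simp add: add_divide_distrib distrib_right del: of_nat_diff)
    ultimately show ?thesis using i'(2) by (simp add: \<psi>_def del: of_nat_diff)
  qed
  have "dot n w' a = dot n (\<lambda>i. (\<beta> / r - 3 * \<kappa>) * ?sh i + (- (\<beta> / r) * s) * ?e i
      + 1 / r * (real (n - i) * w i) + \<psi> i) a"
    by (intro dot_cong split) auto
  also have "\<dots> = (\<beta> / r - 3 * \<kappa>) * dot n ?sh a + (- (\<beta> / r) * s) * dot n ?e a
      + 1 / r * dot n (\<lambda>i. real (n - i) * w i) a + dot n \<psi> a"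
    by (simp only: dot_add_left dot_scale_left)
  also have "dot n ?e a = s" unfolding s_def by (rule dot_unit) (use n in simp)
  finally have *: "dot n w' a = (\<beta> / r - 3 * \<kappa>) * dot n ?sh a + (- (\<beta> / r) * s) * s
      + 1 / r * dot n (\<lambda>i. real (n - i) * w i) a + dot n \<psi> a" .
  have eq: "2 * dot n w' a = (\<beta> / r - 3 * \<kappa>) * (2 * dot n ?sh a) - 2 * (\<beta> / r) * s\<^sup>2
      + 1 / r * (2 * dot n (\<lambda>i. real (n - i) * w i) a) + 2 * dot n \<psi> a"
    unfolding * by (simp add: power2_eq_square algebra_simps)
  have sh: "2 * dot n ?sh a = s\<^sup>2 - W" unfolding a_def s_def W_def by (rule Pbin_shift[OF n])
  have W0: "W \<ge> 0" unfolding W_def a_def by (rule dot_Pbin_nonneg)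
  have sW: "s\<^sup>2 \<le> real n * W" unfolding a_def s_def W_def by (rule Pbin_last_row_bound[OF n])
  have "\<bar>\<psi> i\<bar> \<le> real (n - i) / r * \<bar>w i\<bar> + (\<Sum>j\<in>{1..i}. c i j * r ^ (2 * (i - j)) * \<bar>w j\<bar>)"
    if i: "i \<in> {1..n}" for i
  proof -
    have "\<bar>p i / r ^ (2 * (n - i))\<bar> \<le> (\<Sum>j\<in>{1..i}. c i j * \<bar>x j\<bar>) / r ^ (2 * (n - i))"
      using p[OF i] r by (simp add: abs_divide divide_right_mono)
    also have "\<dots> = (\<Sum>j\<in>{1..i}. c i j * r ^ (2 * (i - j)) * \<bar>w j\<bar>)"
      unfolding sum_divide_distrib
    proof (rule sum.cong[OF refl])
      fix j assume j: "j \<in> {1..i}"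
      have "2 * (n - j) = 2 * (i - j) + 2 * (n - i)" using i j by auto
      then show "c i j * \<bar>x j\<bar> / r ^ (2 * (n - i)) = c i j * r ^ (2 * (i - j)) * \<bar>w j\<bar>"
        using w[of j] i j r by (simp add: abs_mult power_add)
    qed
    finally have 1: "\<bar>p i / r ^ (2 * (n - i))\<bar> \<le> (\<Sum>j\<in>{1..i}. c i j * r ^ (2 * (i - j)) * \<bar>w j\<bar>)" .
    have 2: "\<bar>real (n - i) / r * w i\<bar> = real (n - i) / r * \<bar>w i\<bar>"
      using r by (simp add: abs_mult)
    show ?thesis unfolding \<psi>_def
      by (rule order_trans[OF abs_triangle_ineq add_mono[OF eq_refl[OF 2] 1]])
  qed
  then have "dot n \<psi> \<psi> \<le> (?D / r)\<^sup>2 * dot n w w"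
    by (intro perturbation_bound[OF n r c])
  then have psi: "dot n \<psi> a \<le> Lambda n * (?D / r) * W"
    unfolding a_def W_def using dconst_nonneg(1)[OF n] r by (intro Pbin_cross_bound[OF n]) auto
  have E: "1 / r * (2 * dot n (\<lambda>i. real (n - i) * w i) a) \<le> 1 / r * (lam * W)"
    using lam(3)[of w] r unfolding a_def W_def by (intro mult_left_mono) auto
  have "- \<kappa> * (s\<^sup>2 - W) \<le> \<bar>\<kappa>\<bar> * \<bar>s\<^sup>2 - W\<bar>" by (metis abs_ge_self abs_minus_cancel abs_mult)
  also have "\<dots> \<le> \<bar>\<kappa>\<bar> * ((real n + 1) * W)"
  proof (rule mult_left_mono)
    have "(real n + 1) * W = real n * W + W" by (simp add: distrib_right)
    then show "\<bar>s\<^sup>2 - W\<bar> \<le> (real n + 1) * W" using sW W0 zero_le_power2[of s] by linarith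
  qed auto
  finally have K: "- \<kappa> * (s\<^sup>2 - W) \<le> \<bar>\<kappa>\<bar> * ((real n + 1) * W)" .
  have "\<beta> / r * s\<^sup>2 \<ge> 0" using \<beta>_pos r by simp
  then have "2 * dot n w' a \<le> - (\<beta> / r * W) + 3 * (\<bar>\<kappa>\<bar> * ((real n + 1) * W))
      + 1 / r * (lam * W) + 2 * (Lambda n * (?D / r) * W)"
  proof -
    have "(\<beta> / r - 3 * \<kappa>) * (s\<^sup>2 - W) - 2 * (\<beta> / r) * s\<^sup>2
        = - (\<beta> / r * s\<^sup>2) - \<beta> / r * W + 3 * (- \<kappa> * (s\<^sup>2 - W))" by (simp add: algebra_simps)
    then show ?thesis using \<open>\<beta> / r * s\<^sup>2 \<ge> 0\<close> K E psi unfolding eq sh by linarith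
  qed
  also have "\<dots> = (3 * (real n + 1) * \<bar>\<kappa>\<bar> - 3 / r) * W"
    unfolding \<beta>_eq using r by (simp add: field_simps)
  finally show ?thesis by (simp add: W_def a_def)
qed

subsection \<open>The closed loop\<close>

definition closed_loop ::
  "nat \<Rightarrow> real \<Rightarrow> (nat \<Rightarrow> nat \<Rightarrow> real) \<Rightarrow> (nat \<Rightarrow> real \<Rightarrow> real \<Rightarrow> (nat \<Rightarrow> real) \<Rightarrow> real)
    \<Rightarrow> (real \<Rightarrow> real) \<Rightarrow> (real \<Rightarrow> nat \<Rightarrow> real) \<Rightarrow> bool" where
  "closed_loop n T c \<phi> x0 x \<longleftrightarrow> (\<forall>t\<in>{0..<T}.
     (x0 has_real_derivative u0_fb T (beta_gain n c T) t (x0 t)) (at t within {0..<T}) \<and>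
     (\<forall>i\<in>{1..<n}. ((\<lambda>s. x s i) has_real_derivative
          u0_fb T (beta_gain n c T) t (x0 t) * x t (i + 1)
          + \<phi> i t (u_fb n T (beta_gain n c T) t (x t)) (x t)) (at t within {0..<T})) \<and>
     ((\<lambda>s. x s n) has_real_derivative
          u_fb n T (beta_gain n c T) t (x t)
          + \<phi> n t (u_fb n T (beta_gain n c T) t (x t)) (x t)) (at t within {0..<T}))"

definition scaled_state :: "nat \<Rightarrow> real \<Rightarrow> (real \<Rightarrow> nat \<Rightarrow> real) \<Rightarrow> real \<Rightarrow> nat \<Rightarrow> real" where
  "scaled_state n T x t i = x t i * (1 / (T - t)) ^ (2 * (n - i))"

lemma DERIV_from_within:
  fixes f :: "real \<Rightarrow> real"
  assumes "(f has_real_derivative D) (at t within {0..<T})" "0 < t" "t < T"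
  shows "(f has_real_derivative D) (at t)"
proof -
  have "(f has_real_derivative D) (at t within {0<..<T})"
    using assms(1) by (rule has_field_derivative_subset) auto
  then show ?thesis using assms(2,3) by (simp add: at_within_open[of t "{0<..<T}"])
qed

lemma continuous_on_from_within:
  fixes f :: "real \<Rightarrow> real"
  assumes "\<And>t. t \<in> {0..<T} \<Longrightarrow> \<exists>D. (f has_real_derivative D) (at t within {0..<T})" "t < T"
  shows "continuous_on {0..t} f"
proof (rule continuous_on_subset)
  show "continuous_on {0..<T} f"
    unfolding continuous_on_eq_continuous_within using assms(1) DERIV_continuous by blast
  show "{0..t} \<subseteq> {0..<T}" using assms(2) by auto
qed

lemma DERIV_recip_diff:
  fixes s T :: real
  assumes "s \<noteq> T"
  shows "((\<lambda>s. 1 / (T - s)) has_real_derivative (1 / (T - s))\<^sup>2) (at s)"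
  using assms by (auto intro!: derivative_eq_intros simp: power2_eq_square)

lemma u_fb_eq:
  assumes n: "n \<ge> 1" and T: "T > 0" and t: "t < T"
  shows "u_fb n T b t (x t) = - (b / (T - t)) * mv n (Pbin n) (scaled_state n T x t) n"
proof -
  define g where "g = 1 / (T - t)"
  have g: "g > 0" using t by (simp add: g_def)
  have nn: "n \<in> {1..n}" using n by simp
  have L: "(\<Sum>l\<in>{1..n}. Lmat n g j l * x t l) = g ^ (n - j) * x t j" if "j \<in> {1..n}" for j
  proof -
    have "(\<Sum>l\<in>{1..n}. Lmat n g j l * x t l) = (\<Sum>l\<in>{1..n}. if l = j then g ^ (n - j) * x t l else 0)"
      unfolding Lmat_def using that by (intro sum.cong) auto
    then show ?thesis using that by (simp add: sum.delta)
  qed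
  have sums: "(\<Sum>j\<in>{1..n}. \<Sum>k\<in>{1..n}. bvec n k * Pmat n g k j * (\<Sum>l\<in>{1..n}. Lmat n g j l * x t l))
      = (\<Sum>j\<in>{1..n}. g * (Pbin n n j * scaled_state n T x t j))"
  proof (rule sum.cong[OF refl])
    fix j assume j: "j \<in> {1..n}"
    have "(\<Sum>k\<in>{1..n}. bvec n k * Pmat n g k j * (\<Sum>l\<in>{1..n}. Lmat n g j l * x t l))
        = (\<Sum>k\<in>{1..n}. if k = n then Pscaled n g k j * (g ^ (n - j) * x t j) else 0)"
      unfolding L[OF j] Pmat_eq[OF n g] bvec_def by (intro sum.cong) auto
    also have "\<dots> = Pscaled n g n j * (g ^ (n - j) * x t j)" using nn by (simp add: sum.delta)
    also have "\<dots> = g * (Pbin n n j * scaled_state n T x t j)"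
      unfolding Pscaled_def scaled_state_def g_def[symmetric] by (simp add: mult_2 power_add)
    finally show "(\<Sum>k\<in>{1..n}. bvec n k * Pmat n g k j * (\<Sum>l\<in>{1..n}. Lmat n g j l * x t l))
        = g * (Pbin n n j * scaled_state n T x t j)" .
  qed
  have gT: "T / (T - t) * (1 / T) = g" using T by (simp add: g_def)
  have "u_fb n T b t (x t) = - b * (\<Sum>j\<in>{1..n}. g * (Pbin n n j * scaled_state n T x t j))"
    unfolding u_fb_def gT unfolding g_def[symmetric] sums ..
  also have "\<dots> = - b * (g * mv n (Pbin n) (scaled_state n T x t) n)"
    by (simp add: mv_def sum_distrib_left)
  finally show ?thesis by (simp add: g_def)
qed

lemma x0_closed_form:
  assumes T: "T > 0"
    and ode: "\<And>t. t \<in> {0..<T} \<Longrightarrow> (x0 has_real_derivative u0_fb T b t (x0 t)) (at t within {0..<T})"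
    and t: "t \<in> {0..<T}"
  shows "x0 t = (T - t) ^ 3 * (x0 0 / T ^ 3) - (T - t)\<^sup>2 * (b * t / (2 * T))"
    and "u0_fb T b t (x0 t) = (T - t) * (b - 3 * (T - t) * (x0 0 / T ^ 3 + b / (2 * T)))"
proof -
  define y where "y s = x0 s * (1 / (T - s)) ^ 3 + b / (2 * T) * (s * (1 / (T - s)))" for s
  have "y t = y 0"
  proof (cases "t = 0")
    case False
    then have t0: "0 < t" using t by simp
    have "continuous_on {0..t} x0"
      using ode t by (intro continuous_on_from_within[of T]) auto
    then have cont: "continuous_on {0..t} y"
      unfolding y_def using t by (intro continuous_intros) auto
    have "(y has_real_derivative 0) (at s)" if s: "0 < s" "s < t" for s
    proof -
      define g where "g = 1 / (T - s)"
      have gr: "g * (T - s) = 1" using s t by (simp add: g_def)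
      have D0: "(x0 has_real_derivative u0_fb T b s (x0 s)) (at s)"
        using ode[of s] s t by (intro DERIV_from_within[of _ _ _ T]) auto
      have Dg: "((\<lambda>s. 1 / (T - s)) has_real_derivative g\<^sup>2) (at s)"
        unfolding g_def using s t by (intro DERIV_recip_diff) auto
      have "(y has_real_derivative u0_fb T b s (x0 s) * g ^ 3 + (3 * g\<^sup>2 * g\<^sup>2) * x0 s
          + b / (2 * T) * (g + g\<^sup>2 * s)) (at s)"
        unfolding y_def
        by (rule derivative_eq_intros D0 Dg refl)+ (simp add: g_def power2_eq_square algebra_simps)
      also have "u0_fb T b s (x0 s) * g ^ 3 + (3 * g\<^sup>2 * g\<^sup>2) * x0 s + b / (2 * T) * (g + g\<^sup>2 * s) = 0"
      proof -
        have 1: "u0_fb T b s (x0 s) = - 3 * g * x0 s - b / 2 * (T - s)"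
          by (simp add: u0_fb_def g_def)
        have "g + g\<^sup>2 * s = g\<^sup>2 * (g * (T - s)) * 0 + g * (g * (T - s)) + g\<^sup>2 * s"
          unfolding gr by simp
        also have "\<dots> = g\<^sup>2 * T" by (simp add: power2_eq_square algebra_simps)
        finally have 2: "g + g\<^sup>2 * s = g\<^sup>2 * T" .
        have "u0_fb T b s (x0 s) * g ^ 3 = - 3 * g ^ 4 * x0 s - b / 2 * g\<^sup>2 * (g * (T - s))"
          unfolding 1 by (simp add: eval_nat_numeral algebra_simps)
        then show ?thesis unfolding gr 2 using T by (simp add: eval_nat_numeral)
      qed
      finally show ?thesis .
    qed
    then show ?thesis using DERIV_isconst_end[OF t0 cont] by blast
  qed simp
  then have eq: "x0 t * (1 / (T - t)) ^ 3 + b / (2 * T) * (t * (1 / (T - t))) = x0 0 / T ^ 3"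
    by (simp add: y_def power_one_over)
  define r where "r = T - t"
  have r: "r > 0" using t by (simp add: r_def)
  have "x0 t = r ^ 3 * (x0 t * (1 / r) ^ 3 + b / (2 * T) * (t * (1 / r))) - r\<^sup>2 * (b * t / (2 * T))"
    using r T by (simp add: field_simps eval_nat_numeral)
  then have sol: "x0 t = r ^ 3 * (x0 0 / T ^ 3) - r\<^sup>2 * (b * t / (2 * T))"
    using eq unfolding r_def[symmetric] by metis
  then show "x0 t = (T - t) ^ 3 * (x0 0 / T ^ 3) - (T - t)\<^sup>2 * (b * t / (2 * T))"
    by (simp add: r_def)
  have tr: "t = T - r" by (simp add: r_def)
  have "u0_fb T b t (x0 t) = - 3 / r * x0 t - b / 2 * r" by (simp add: u0_fb_def r_def)
  also have "\<dots> = - 3 * r\<^sup>2 * (x0 0 / T ^ 3) + 3 * r * (b * t / (2 * T)) - b / 2 * r"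
    unfolding sol using r by (simp add: power2_eq_square power3_eq_cube right_diff_distrib)
  also have "b * t / (2 * T) = b / 2 - b * r / (2 * T)"
    unfolding tr using T by (simp add: field_simps)
  also have "- 3 * r\<^sup>2 * (x0 0 / T ^ 3) + 3 * r * (b / 2 - b * r / (2 * T)) - b / 2 * r
      = r * (b - 3 * r * (x0 0 / T ^ 3 + b / (2 * T)))"
    by (simp add: power2_eq_square algebra_simps)
  finally show "u0_fb T b t (x0 t) = (T - t) * (b - 3 * (T - t) * (x0 0 / T ^ 3 + b / (2 * T)))"
    by (simp add: r_def)
qed

lemma Gronwall_cubic:
  fixes W :: "real \<Rightarrow> real"
  assumes T: "T > 0" and t: "t \<in> {0..<T}"
    and cont: "continuous_on {0..t} W"
    and deriv: "\<And>s. 0 < s \<Longrightarrow> s < t \<Longrightarrow> (W has_real_derivative W' s) (at s)"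
    and le: "\<And>s. 0 < s \<Longrightarrow> s < t \<Longrightarrow> W' s \<le> (a - 3 / (T - s)) * W s"
  shows "W t \<le> ((T - t) / T) ^ 3 * exp (a * t) * W 0"
proof -
  define h where "h s = W s * (exp (- a * s) * (1 / (T - s)) ^ 3)" for s
  have "h t \<le> h 0"
  proof (rule DERIV_nonpos_imp_decreasing_open[of 0 t h])
    show "continuous_on {0..t} h" unfolding h_def using t cont by (intro continuous_intros) auto
    fix s assume s: "0 < s" "s < t"
    define g e where "g = 1 / (T - s)" and "e = exp (- a * s)"
    have g: "g > 0" using s t by (simp add: g_def)
    have Dg: "((\<lambda>s. 1 / (T - s)) has_real_derivative g\<^sup>2) (at s)"
      unfolding g_def using s t by (intro DERIV_recip_diff) auto
    have "(h has_real_derivative (W' s - (a - 3 * g) * W s) * (e * g ^ 3)) (at s)"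
      unfolding h_def
      by (rule deriv[OF s] Dg derivative_eq_intros refl)+
        (simp only: g_def[symmetric] e_def[symmetric], simp add: eval_nat_numeral algebra_simps)
    moreover have "(W' s - (a - 3 * g) * W s) * (e * g ^ 3) \<le> 0"
      using le[OF s] g by (intro mult_nonpos_nonneg) (auto simp: g_def e_def)
    ultimately show "\<exists>D. (h has_real_derivative D) (at s) \<and> D \<le> 0" by blast
  qed (use t in simp)
  then have "((T - t) ^ 3 * exp (a * t)) * h t \<le> ((T - t) ^ 3 * exp (a * t)) * h 0"
    using t by (intro mult_left_mono) auto
  moreover have "((T - t) ^ 3 * exp (a * t)) * h t = W t"
    using t by (simp add: h_def power_one_over exp_minus field_simps)
  moreover have "((T - t) ^ 3 * exp (a * t)) * h 0 = ((T - t) / T) ^ 3 * exp (a * t) * W 0"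
    by (simp add: h_def power_divide)
  ultimately show ?thesis by simp
qed

lemma Lyapunov_decay:
  fixes T :: real
  assumes n: "n \<ge> 1" and T: "T > 0"
    and c: "\<And>i j. 1 \<le> j \<Longrightarrow> j \<le> i \<Longrightarrow> i \<le> n \<Longrightarrow> c i j \<ge> 0"
    and phi: "\<And>i t u x. i \<in> {1..n} \<Longrightarrow> \<bar>\<phi> i t u x\<bar> \<le> (\<Sum>j\<in>{1..i}. c i j * \<bar>x j\<bar>)"
    and sol: "closed_loop n T c \<phi> x0 x"
    and t: "t \<in> {0..<T}"
    and w: "w = scaled_state n T x"
    and a: "a = 3 * (real n + 1) * \<bar>x0 0 / T ^ 3 + beta_gain n c T / (2 * T)\<bar>"
  shows "dot n (w t) (mv n (Pbin n) (w t))
    \<le> ((T - t) / T) ^ 3 * exp (a * t) * dot n (w 0) (mv n (Pbin n) (w 0))"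
proof -
  define \<beta> \<kappa> where "\<beta> = beta_gain n c T" and "\<kappa> = x0 0 / T ^ 3 + \<beta> / (2 * T)"
  define U where "U s = u_fb n T \<beta> s (x s)" for s
  define V where "V s = u0_fb T \<beta> s (x0 s)" for s
  define x' where "x' s i = (if i < n then V s * x s (i + 1) else U s) + \<phi> i s (U s) (x s)" for s i
  define w' where "w' s i = real (2 * (n - i)) / (T - s) * w s i + x' s i / (T - s) ^ (2 * (n - i))" for s i
  have ode0: "(x0 has_real_derivative V s) (at s within {0..<T})" if "s \<in> {0..<T}" for s
    using sol that unfolding closed_loop_def V_def \<beta>_def by blast
  have ode: "((\<lambda>s. x s i) has_real_derivative x' s i) (at s within {0..<T})"
    if "s \<in> {0..<T}" "i \<in> {1..n}" for s i
  proof (cases "i = n")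
    case True
    then show ?thesis using sol that(1) by (simp add: closed_loop_def U_def V_def \<beta>_def x'_def)
  next
    case False
    then have "i \<in> {1..<n}" using that by auto
    then show ?thesis using sol that(1) by (simp add: closed_loop_def U_def V_def \<beta>_def x'_def)
  qed
  have contx: "continuous_on {0..t} (\<lambda>s. x s i)" if "i \<in> {1..n}" for i
    using ode[OF _ that] t by (intro continuous_on_from_within[of T]) auto
  have contw: "continuous_on {0..t} (\<lambda>s. w s i)" if "i \<in> {1..n}" for i
    unfolding w scaled_state_def using contx[OF that] t by (intro continuous_intros) auto
  show ?thesis
  proof (rule Gronwall_cubic[OF T t, where W' = "\<lambda>s. 2 * dot n (w' s) (mv n (Pbin n) (w s))"])
    show "continuous_on {0..t} (\<lambda>s. dot n (w s) (mv n (Pbin n) (w s)))"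
      unfolding dot_def mv_def
      by (intro continuous_on_sum continuous_on_mult continuous_on_const contw)
  next
    fix s assume s: "0 < s" "s < t"
    then have sT: "s \<in> {0..<T}" "s < T" using t by auto
    have Dw: "((\<lambda>s. w s i) has_real_derivative w' s i) (at s)" if i: "i \<in> {1..n}" for i
    proof -
      define g m where "g = 1 / (T - s)" and "m = 2 * (n - i)"
      have Dx: "((\<lambda>s. x s i) has_real_derivative x' s i) (at s)"
        using ode[OF sT(1) i] s sT by (intro DERIV_from_within[of _ _ _ T]) auto
      have Dg: "((\<lambda>s. 1 / (T - s)) has_real_derivative g\<^sup>2) (at s)"
        unfolding g_def using sT by (intro DERIV_recip_diff) auto
      have "((\<lambda>s. x s i * (1 / (T - s)) ^ m) has_real_derivative
          x' s i * g ^ m + real m * (g\<^sup>2 * g ^ (m - 1)) * x s i) (at s)"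
        by (rule derivative_eq_intros Dx Dg refl)+ (simp add: g_def[symmetric])
      also have "real m * (g\<^sup>2 * g ^ (m - 1)) = real m * g * g ^ m"
        by (cases m) (simp_all add: power2_eq_square)
      also have "x' s i * g ^ m + real m * g * g ^ m * x s i = w' s i"
        by (simp add: w'_def w scaled_state_def m_def g_def power_one_over divide_simps del: of_nat_diff)
      finally show ?thesis by (simp add: w scaled_state_def m_def)
    qed
    have "((\<lambda>s. dot n (w s) (mv n (Pbin n) (w s))) has_real_derivative
        dot n (w' s) (mv n (Pbin n) (w s)) + dot n (w s) (mv n (Pbin n) (w' s))) (at s)"
    proof -
      have "((\<lambda>s. mv n (Pbin n) (w s) i) has_real_derivative mv n (Pbin n) (w' s) i) (at s)" for i
        unfolding mv_def by (intro DERIV_sum DERIV_cmult Dw)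
      then have "((\<lambda>s. dot n (w s) (mv n (Pbin n) (w s))) has_real_derivative
          (\<Sum>i\<in>{1..n}. w' s i * mv n (Pbin n) (w s) i + mv n (Pbin n) (w' s) i * w s i)) (at s)"
        unfolding dot_def by (intro DERIV_sum DERIV_mult Dw)
      then show ?thesis by (simp add: dot_def sum.distrib mult.commute)
    qed
    also have "dot n (w s) (mv n (Pbin n) (w' s)) = dot n (w' s) (mv n (Pbin n) (w s))"
      by (rule dot_mv_sym) (rule Pbin_sym)
    finally show "((\<lambda>s. dot n (w s) (mv n (Pbin n) (w s))) has_real_derivative
        2 * dot n (w' s) (mv n (Pbin n) (w s))) (at s)" by simp
    show "2 * dot n (w' s) (mv n (Pbin n) (w s)) \<le> (a - 3 / (T - s)) * dot n (w s) (mv n (Pbin n) (w s))"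
      unfolding a \<beta>_def[symmetric] \<kappa>_def[symmetric]
    proof (rule Lyapunov_rate[OF n _ _ c _ _ \<beta>_def, where x = "x s" and p = "\<lambda>i. \<phi> i s (U s) (x s)"
          and x' = "x' s" and v = "V s"])
      show "0 < T - s" "T - s \<le> T" using s sT by auto
      show "x s i = (T - s) ^ (2 * (n - i)) * w s i" for i
        using sT by (simp add: w scaled_state_def power_one_over)
      show "\<bar>\<phi> i s (U s) (x s)\<bar> \<le> (\<Sum>j\<in>{1..i}. c i j * \<bar>x s j\<bar>)" if "i \<in> {1..n}" for i
        by (rule phi[OF that])
      show "V s = (T - s) * (\<beta> - 3 * (T - s) * \<kappa>)"
        using x0_closed_form(2)[of T x0 \<beta> s] T ode0 sT(1) unfolding V_def \<kappa>_def by blast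
      show "x' s i = V s * x s (i + 1) + \<phi> i s (U s) (x s)" if "i \<in> {1..<n}" for i
        using that by (simp add: x'_def)
      show "x' s n = - (\<beta> / (T - s)) * mv n (Pbin n) (w s) n + \<phi> n s (U s) (x s)"
        using u_fb_eq[OF n T sT(2), of \<beta> x] by (simp add: x'_def U_def w)
      show "w' s i = real (2 * (n - i)) / (T - s) * w s i + x' s i / (T - s) ^ (2 * (n - i))" for i
        by (simp add: w'_def)
    qed
  qed
qed

lemma vnorm_nonneg: "vnorm n v \<ge> 0"
  by (simp add: vnorm_dot dot_self_nonneg)

lemma vnorm_sq: "(vnorm n v)\<^sup>2 = dot n v v"
  by (simp add: vnorm_dot dot_self_nonneg)

lemma vnorm_le_mult:
  assumes "M \<ge> 0" "\<And>i. i \<in> {1..n} \<Longrightarrow> \<bar>v i\<bar> \<le> M * \<bar>w i\<bar>"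
  shows "vnorm n v \<le> M * vnorm n w"
proof (rule power2_le_imp_le)
  have "(vnorm n v)\<^sup>2 = (\<Sum>i\<in>{1..n}. \<bar>v i\<bar>\<^sup>2)"
    unfolding vnorm_sq by (simp add: dot_def power2_eq_square)
  also have "\<dots> \<le> (\<Sum>i\<in>{1..n}. (M * \<bar>w i\<bar>)\<^sup>2)"
    using assms(2) by (intro sum_mono power_mono) auto
  also have "\<dots> = (M * vnorm n w)\<^sup>2"
    by (simp add: power_mult_distrib vnorm_sq) (simp add: dot_def sum_distrib_left power2_eq_square)
  finally show "(vnorm n v)\<^sup>2 \<le> (M * vnorm n w)\<^sup>2" .
qed (use assms(1) vnorm_nonneg in auto)

lemma abs_le_vnorm:
  assumes "i \<in> {1..n}"
  shows "\<bar>v i\<bar> \<le> vnorm n v"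
proof (rule power2_le_imp_le[OF _ vnorm_nonneg])
  have "v i * v i \<le> dot n v v"
    unfolding dot_def using assms by (intro member_le_sum) auto
  then show "\<bar>v i\<bar>\<^sup>2 \<le> (vnorm n v)\<^sup>2" unfolding vnorm_sq by (simp add: power2_eq_square)
qed

lemma power_le_max_power:
  fixes a b :: real
  assumes "0 \<le> a" "a \<le> b" "m \<le> N"
  shows "a ^ m \<le> max 1 b ^ N"
proof -
  have "a ^ m \<le> max 1 b ^ m" using assms by (intro power_mono) auto
  also have "\<dots> \<le> max 1 b ^ N" using assms by (intro power_increasing) auto
  finally show ?thesis .
qed

lemma tendsto_0_at_left_bound:
  fixes f B :: "real \<Rightarrow> real"
  assumes "T > 0" "\<And>t. t \<in> {0..<T} \<Longrightarrow> \<bar>f t\<bar> \<le> B t" "(B \<longlongrightarrow> 0) (at_left T)"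
  shows "(f \<longlongrightarrow> 0) (at_left T)"
proof (rule Lim_null_comparison[OF _ assms(3)])
  show "\<forall>\<^sub>F t in at_left T. norm (f t) \<le> B t"
    unfolding eventually_at_left[OF assms(1)] using assms(1,2) by (intro exI[of _ 0]) auto
qed

lemma scaled_state_bound:
  assumes n: "n \<ge> 1" and T: "T > 0"
    and c: "\<And>i j. 1 \<le> j \<Longrightarrow> j \<le> i \<Longrightarrow> i \<le> n \<Longrightarrow> c i j \<ge> 0"
    and phi: "\<And>i t u x. i \<in> {1..n} \<Longrightarrow> \<bar>\<phi> i t u x\<bar> \<le> (\<Sum>j\<in>{1..i}. c i j * \<bar>x j\<bar>)"
    and sol: "closed_loop n T c \<phi> x0 x"
    and t: "t \<in> {0..<T}"
  shows "vnorm n (scaled_state n T x t)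
    \<le> Lambda n / sqrt (T ^ 3) * exp (3 * (real n + 1) * beta_gain n c T / 4) * max 1 (1 / T) ^ (2 * n)
      * (T - t) powr (3 / 2) * exp (3 * (real n + 1) / (2 * T ^ 3) * \<bar>x0 0\<bar> * t) * vnorm n (x 0)"
proof -
  define w where "w = scaled_state n T x"
  define \<beta> where "\<beta> = beta_gain n c T"
  define N where "N = 3 * (real n + 1)"
  define M where "M = max 1 (1 / T) ^ (2 * n)"
  define r where "r = T - t"
  define a where "a = N * \<bar>x0 0 / T ^ 3 + \<beta> / (2 * T)\<bar>"
  have N: "N > 0" by (simp add: N_def)
  have \<beta>: "\<beta> > 0" unfolding \<beta>_def by (rule beta_gain_pos[OF n])
  have r: "r > 0" using t by (simp add: r_def)
  note Lam = Lambda_pos[OF n]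
  have M: "M \<ge> 0" by (simp add: M_def)
  have w0: "vnorm n (w 0) \<le> M * vnorm n (x 0)"
  proof (rule vnorm_le_mult[OF M])
    fix i
    have "(1 / T) ^ (2 * (n - i)) \<le> M"
      unfolding M_def using T by (intro power_le_max_power) auto
    then have "(1 / T) ^ (2 * (n - i)) * \<bar>x 0 i\<bar> \<le> M * \<bar>x 0 i\<bar>" by (rule mult_right_mono) simp
    then show "\<bar>w 0 i\<bar> \<le> M * \<bar>x 0 i\<bar>"
      using T by (simp add: w_def scaled_state_def abs_mult mult.commute)
  qed
  have "\<bar>x0 0 / T ^ 3 + \<beta> / (2 * T)\<bar> \<le> \<bar>x0 0\<bar> / T ^ 3 + \<beta> / (2 * T)"
    using T \<beta> by (intro order_trans[OF abs_triangle_ineq]) (simp add: abs_divide)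
  then have "a * t \<le> N * (\<bar>x0 0\<bar> / T ^ 3 + \<beta> / (2 * T)) * t"
    unfolding a_def using N t by (intro mult_right_mono mult_left_mono) auto
  also have "\<dots> = N * \<bar>x0 0\<bar> / T ^ 3 * t + N * \<beta> / 2 * (t / T)"
    by (simp add: algebra_simps)
  also have "\<dots> \<le> N * \<bar>x0 0\<bar> / T ^ 3 * t + N * \<beta> / 2 * 1"
    using N \<beta> T t by (intro add_left_mono mult_left_mono) auto
  also have "\<dots> = 2 * (N * \<beta> / 4) + 2 * (N / (2 * T ^ 3) * \<bar>x0 0\<bar> * t)" by simp
  finally have "exp (a * t) \<le> exp (2 * (N * \<beta> / 4) + 2 * (N / (2 * T ^ 3) * \<bar>x0 0\<bar> * t))" by simp
  also have "\<dots> = (exp (N * \<beta> / 4))\<^sup>2 * (exp (N / (2 * T ^ 3) * \<bar>x0 0\<bar> * t))\<^sup>2"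
    by (simp only: exp_add exp_double)
  finally have e: "exp (a * t) \<le> (exp (N * \<beta> / 4))\<^sup>2 * (exp (N / (2 * T ^ 3) * \<bar>x0 0\<bar> * t))\<^sup>2" .
  have p: "(r powr (3 / 2))\<^sup>2 = r ^ 3"
    using r by (simp add: power2_eq_square flip: powr_add powr_numeral)
  have "(vnorm n (w t))\<^sup>2 \<le> Lambda n * dot n (w t) (mv n (Pbin n) (w t))"
    unfolding vnorm_sq by (rule dot_self_le_Lambda_Pbin[OF n])
  also have "\<dots> \<le> Lambda n * ((r / T) ^ 3 * exp (a * t) * dot n (w 0) (mv n (Pbin n) (w 0)))"
    using Lyapunov_decay[OF n T c phi sol t w_def] Lam unfolding a_def N_def \<beta>_def r_def
    by (intro mult_left_mono) auto
  also have "\<dots> \<le> Lambda n * ((r / T) ^ 3 * ((exp (N * \<beta> / 4))\<^sup>2 * (exp (N / (2 * T ^ 3) * \<bar>x0 0\<bar> * t))\<^sup>2)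
      * (Lambda n * (M * vnorm n (x 0))\<^sup>2))"
  proof (intro mult_left_mono mult_mono e)
    have "dot n (w 0) (mv n (Pbin n) (w 0)) \<le> Lambda n * (vnorm n (w 0))\<^sup>2"
      unfolding vnorm_sq by (rule dot_Pbin_le_Lambda[OF n])
    also have "\<dots> \<le> Lambda n * (M * vnorm n (x 0))\<^sup>2"
      using w0 Lam vnorm_nonneg by (intro mult_left_mono power_mono) auto
    finally show "dot n (w 0) (mv n (Pbin n) (w 0)) \<le> Lambda n * (M * vnorm n (x 0))\<^sup>2" .
  qed (use r T Lam dot_Pbin_nonneg in auto)
  also have "\<dots> = (Lambda n / sqrt (T ^ 3) * exp (N * \<beta> / 4) * M * r powr (3 / 2)
      * exp (N / (2 * T ^ 3) * \<bar>x0 0\<bar> * t) * vnorm n (x 0))\<^sup>2"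
    unfolding power_mult_distrib p power_divide using T by (simp add: power2_eq_square)
  finally have "vnorm n (w t) \<le> Lambda n / sqrt (T ^ 3) * exp (N * \<beta> / 4) * M * r powr (3 / 2)
      * exp (N / (2 * T ^ 3) * \<bar>x0 0\<bar> * t) * vnorm n (x 0)"
    by (rule power2_le_imp_le) (use Lam M T vnorm_nonneg in \<open>simp add: zero_le_mult_iff\<close>)
  then show ?thesis by (simp only: w_def N_def \<beta>_def M_def r_def)
qed

theorem theorem1:
  fixes n :: nat and T :: real
    and c :: "nat \<Rightarrow> nat \<Rightarrow> real"
    and \<phi> :: "nat \<Rightarrow> real \<Rightarrow> real \<Rightarrow> (nat \<Rightarrow> real) \<Rightarrow> real"
  assumes n: "n \<ge> 1"
    and T: "T > 0"
    and c_nonneg: "\<And>i j. 1 \<le> j \<Longrightarrow> j \<le> i \<Longrightarrow> i \<le> n \<Longrightarrow> c i j \<ge> 0"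
    and phi_cont: "\<And>i. i \<in> {1..n} \<Longrightarrow> continuous_on UNIV (\<lambda>(t, u, x). \<phi> i t u x)"
    and phi_bound: "\<And>i t u x. i \<in> {1..n} \<Longrightarrow>
                      \<bar>\<phi> i t u x\<bar> \<le> (\<Sum>j\<in>{1..i}. c i j * \<bar>x j\<bar>)"
  shows "\<exists>v1 v10 v2 v20 :: real. v1 > 0 \<and> v10 > 0 \<and> v2 > 0 \<and> v20 > 0 \<and>
    (\<forall>(x0 :: real \<Rightarrow> real) (x :: real \<Rightarrow> nat \<Rightarrow> real).
      (\<forall>t\<in>{0..<T}.
         (x0 has_real_derivative u0_fb T (beta_gain n c T) t (x0 t)) (at t within {0..<T}) \<and>
         (\<forall>i\<in>{1..<n}. ((\<lambda>s. x s i) has_real_derivative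
              u0_fb T (beta_gain n c T) t (x0 t) * x t (i + 1)
              + \<phi> i t (u_fb n T (beta_gain n c T) t (x t)) (x t)) (at t within {0..<T})) \<and>
         ((\<lambda>s. x s n) has_real_derivative
              u_fb n T (beta_gain n c T) t (x t)
              + \<phi> n t (u_fb n T (beta_gain n c T) t (x t)) (x t)) (at t within {0..<T}))
      \<longrightarrow>
      (\<forall>t\<in>{0..<T}.
         \<bar>x0 t\<bar> \<le> (T - t)\<^sup>2 * ((T - t) / T ^ 3 * \<bar>x0 0\<bar> + beta_gain n c T * t / (2 * T)) \<and>
         \<bar>u0_fb T (beta_gain n c T) t (x0 t)\<bar>
            \<le> (T - t) * (3 * (T - t) * (\<bar>x0 0\<bar> / T ^ 3 + beta_gain n c T / (2 * T))
                         + beta_gain n c T) \<and>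
         vnorm n (x t) \<le> v1 * (T - t) powr (3 / 2) * exp (v10 * \<bar>x0 0\<bar> * t) * vnorm n (x 0) \<and>
         \<bar>u_fb n T (beta_gain n c T) t (x t)\<bar>
            \<le> v2 * (T - t) powr (1 / 2) * exp (v20 * \<bar>x0 0\<bar> * t) * vnorm n (x 0)) \<and>
      (x0 \<longlongrightarrow> 0) (at_left T) \<and>
      ((\<lambda>t. u0_fb T (beta_gain n c T) t (x0 t)) \<longlongrightarrow> 0) (at_left T) \<and>
      (\<forall>i\<in>{1..n}. ((\<lambda>t. x t i) \<longlongrightarrow> 0) (at_left T)) \<and>
      ((\<lambda>t. u_fb n T (beta_gain n c T) t (x t)) \<longlongrightarrow> 0) (at_left T))"
proof -
  define \<beta> where "\<beta> = beta_gain n c T"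
  have \<beta>: "\<beta> > 0" unfolding \<beta>_def by (rule beta_gain_pos[OF n])
  define C where "C = Lambda n / sqrt (T ^ 3) * exp (3 * (real n + 1) * \<beta> / 4) * max 1 (1 / T) ^ (2 * n)"
  define v1 where "v1 = max 1 T ^ (2 * n) * C"
  define v2 where "v2 = \<beta> * sqrt (real n * Lambda n) * C"
  define v where "v = 3 * (real n + 1) / (2 * T ^ 3)"
  note Lam = Lambda_pos[OF n]
  have C: "C > 0" unfolding C_def using Lam T by (intro mult_pos_pos zero_less_power) auto
  have v1: "v1 > 0" unfolding v1_def using C by (intro mult_pos_pos zero_less_power) auto
  have v2: "v2 > 0" unfolding v2_def using C \<beta> n Lam by (intro mult_pos_pos) auto
  have v: "v > 0" unfolding v_def using T by (intro divide_pos_pos) auto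
  have main: "(\<forall>t\<in>{0..<T}.
         \<bar>x0 t\<bar> \<le> (T - t)\<^sup>2 * ((T - t) / T ^ 3 * \<bar>x0 0\<bar> + \<beta> * t / (2 * T)) \<and>
         \<bar>u0_fb T \<beta> t (x0 t)\<bar>
            \<le> (T - t) * (3 * (T - t) * (\<bar>x0 0\<bar> / T ^ 3 + \<beta> / (2 * T)) + \<beta>) \<and>
         vnorm n (x t) \<le> v1 * (T - t) powr (3 / 2) * exp (v * \<bar>x0 0\<bar> * t) * vnorm n (x 0) \<and>
         \<bar>u_fb n T \<beta> t (x t)\<bar>
            \<le> v2 * (T - t) powr (1 / 2) * exp (v * \<bar>x0 0\<bar> * t) * vnorm n (x 0)) \<and>
      (x0 \<longlongrightarrow> 0) (at_left T) \<and>
      ((\<lambda>t. u0_fb T \<beta> t (x0 t)) \<longlongrightarrow> 0) (at_left T) \<and>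
      (\<forall>i\<in>{1..n}. ((\<lambda>t. x t i) \<longlongrightarrow> 0) (at_left T)) \<and>
      ((\<lambda>t. u_fb n T \<beta> t (x t)) \<longlongrightarrow> 0) (at_left T)"
    if sol: "closed_loop n T c \<phi> x0 x" for x0 x
  proof -
    have ode0: "(x0 has_real_derivative u0_fb T \<beta> t (x0 t)) (at t within {0..<T})" if "t \<in> {0..<T}" for t
      using sol that unfolding closed_loop_def \<beta>_def by blast
    have x0_t: "x0 t = (T - t) ^ 3 * (x0 0 / T ^ 3) - (T - t)\<^sup>2 * (\<beta> * t / (2 * T))"
      and u0_t: "u0_fb T \<beta> t (x0 t) = (T - t) * (\<beta> - 3 * (T - t) * (x0 0 / T ^ 3 + \<beta> / (2 * T)))"
      if "t \<in> {0..<T}" for t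
      using x0_closed_form[of T x0 \<beta> t] T ode0 that by blast+
    have b1: "\<bar>x0 t\<bar> \<le> (T - t)\<^sup>2 * ((T - t) / T ^ 3 * \<bar>x0 0\<bar> + \<beta> * t / (2 * T))"
      if t: "t \<in> {0..<T}" for t
    proof -
      have "\<bar>x0 t\<bar> \<le> \<bar>(T - t) ^ 3 * (x0 0 / T ^ 3)\<bar> + \<bar>(T - t)\<^sup>2 * (\<beta> * t / (2 * T))\<bar>"
        unfolding x0_t[OF t] by (rule abs_triangle_ineq4)
      also have "\<bar>(T - t) ^ 3 * (x0 0 / T ^ 3)\<bar> = (T - t) ^ 3 * (\<bar>x0 0\<bar> / T ^ 3)"
        using t T by (simp add: abs_mult)
      also have "\<bar>(T - t)\<^sup>2 * (\<beta> * t / (2 * T))\<bar> = (T - t)\<^sup>2 * (\<beta> * t / (2 * T))"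
        using t T \<beta> by (intro abs_of_nonneg) simp
      also have "(T - t) ^ 3 * (\<bar>x0 0\<bar> / T ^ 3) + (T - t)\<^sup>2 * (\<beta> * t / (2 * T))
          = (T - t)\<^sup>2 * ((T - t) / T ^ 3 * \<bar>x0 0\<bar> + \<beta> * t / (2 * T))"
        by (simp add: distrib_left power2_eq_square power3_eq_cube mult_ac)
      finally show ?thesis .
    qed
    have b2: "\<bar>u0_fb T \<beta> t (x0 t)\<bar>
        \<le> (T - t) * (3 * (T - t) * (\<bar>x0 0\<bar> / T ^ 3 + \<beta> / (2 * T)) + \<beta>)" if t: "t \<in> {0..<T}" for t
    proof -
      define \<kappa> where "\<kappa> = x0 0 / T ^ 3 + \<beta> / (2 * T)"
      have r: "T - t > 0" using t by simp
      have "\<bar>\<kappa>\<bar> \<le> \<bar>x0 0\<bar> / T ^ 3 + \<beta> / (2 * T)"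
        unfolding \<kappa>_def using T \<beta> by (intro order_trans[OF abs_triangle_ineq]) (simp add: abs_divide)
      then have "3 * (T - t) * \<bar>\<kappa>\<bar> \<le> 3 * (T - t) * (\<bar>x0 0\<bar> / T ^ 3 + \<beta> / (2 * T))"
        using r by (intro mult_left_mono) auto
      moreover have "\<bar>\<beta> - 3 * (T - t) * \<kappa>\<bar> \<le> \<bar>\<beta>\<bar> + \<bar>3 * (T - t) * \<kappa>\<bar>" by (rule abs_triangle_ineq4)
      moreover have "\<bar>3 * (T - t) * \<kappa>\<bar> = 3 * (T - t) * \<bar>\<kappa>\<bar>" using r by (simp add: abs_mult)
      ultimately have "\<bar>\<beta> - 3 * (T - t) * \<kappa>\<bar> \<le> 3 * (T - t) * (\<bar>x0 0\<bar> / T ^ 3 + \<beta> / (2 * T)) + \<beta>"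
        using \<beta> by simp
      then have "(T - t) * \<bar>\<beta> - 3 * (T - t) * \<kappa>\<bar>
          \<le> (T - t) * (3 * (T - t) * (\<bar>x0 0\<bar> / T ^ 3 + \<beta> / (2 * T)) + \<beta>)"
        using r by (intro mult_left_mono) auto
      then show ?thesis
        unfolding u0_t[OF t] \<kappa>_def[symmetric] using r by (simp add: abs_mult)
    qed
    define w where "w = scaled_state n T x"
    have wb: "vnorm n (w t) \<le> C * (T - t) powr (3 / 2) * exp (v * \<bar>x0 0\<bar> * t) * vnorm n (x 0)"
      if t: "t \<in> {0..<T}" for t
      unfolding w_def C_def v_def \<beta>_def by (rule scaled_state_bound[OF n T c_nonneg phi_bound sol t])
    have b3: "vnorm n (x t) \<le> v1 * (T - t) powr (3 / 2) * exp (v * \<bar>x0 0\<bar> * t) * vnorm n (x 0)"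
      if t: "t \<in> {0..<T}" for t
    proof -
      have "vnorm n (x t) \<le> max 1 T ^ (2 * n) * vnorm n (w t)"
      proof (rule vnorm_le_mult)
        fix i
        have "(T - t) ^ (2 * (n - i)) \<le> max 1 T ^ (2 * n)"
          using t by (intro power_le_max_power) auto
        then have "(T - t) ^ (2 * (n - i)) * \<bar>w t i\<bar> \<le> max 1 T ^ (2 * n) * \<bar>w t i\<bar>"
          by (rule mult_right_mono) simp
        moreover have "x t i = (T - t) ^ (2 * (n - i)) * w t i"
          using t by (simp add: w_def scaled_state_def power_one_over)
        ultimately show "\<bar>x t i\<bar> \<le> max 1 T ^ (2 * n) * \<bar>w t i\<bar>" using t by (simp add: abs_mult)
      qed simp
      also have "\<dots> \<le> max 1 T ^ (2 * n) * (C * (T - t) powr (3 / 2) * exp (v * \<bar>x0 0\<bar> * t) * vnorm n (x 0))"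
        by (intro mult_left_mono wb[OF t]) simp
      finally show ?thesis by (simp add: v1_def mult.assoc)
    qed
    have b4: "\<bar>u_fb n T \<beta> t (x t)\<bar>
        \<le> v2 * (T - t) powr (1 / 2) * exp (v * \<bar>x0 0\<bar> * t) * vnorm n (x 0)"
      if t: "t \<in> {0..<T}" for t
    proof -
      have r: "T - t > 0" using t by simp
      define s where "s = mv n (Pbin n) (w t) n"
      have "s\<^sup>2 \<le> real n * dot n (w t) (mv n (Pbin n) (w t))"
        unfolding s_def by (rule Pbin_last_row_bound[OF n])
      also have "\<dots> \<le> real n * (Lambda n * (vnorm n (w t))\<^sup>2)"
        unfolding vnorm_sq by (intro mult_left_mono dot_Pbin_le_Lambda[OF n]) simp
      finally have "\<bar>s\<bar> \<le> sqrt (real n * (Lambda n * (vnorm n (w t))\<^sup>2))"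
        by (rule real_le_rsqrt[OF eq_refl[THEN order_trans], rotated]) simp
      also have "\<dots> = sqrt (real n * Lambda n) * vnorm n (w t)"
        using vnorm_nonneg[of n "w t"] by (simp add: real_sqrt_mult)
      also have "\<dots> \<le> sqrt (real n * Lambda n) * (C * (T - t) powr (3 / 2) * exp (v * \<bar>x0 0\<bar> * t) * vnorm n (x 0))"
        using Lam by (intro mult_left_mono wb[OF t]) simp
      also have "(T - t) powr (3 / 2) = (T - t) * (T - t) powr (1 / 2)"
        using r powr_add[of "T - t" 1 "1 / 2"] by simp
      finally have s: "\<bar>s\<bar> \<le> sqrt (real n * Lambda n) *
          (C * ((T - t) * (T - t) powr (1 / 2)) * exp (v * \<bar>x0 0\<bar> * t) * vnorm n (x 0))" .
      have "\<bar>u_fb n T \<beta> t (x t)\<bar> = \<beta> / (T - t) * \<bar>s\<bar>"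
        using u_fb_eq[OF n T, of t \<beta> x] t \<beta> by (simp add: s_def w_def abs_mult)
      also have "\<dots> \<le> \<beta> / (T - t) * (sqrt (real n * Lambda n) *
          (C * ((T - t) * (T - t) powr (1 / 2)) * exp (v * \<bar>x0 0\<bar> * t) * vnorm n (x 0)))"
        using \<beta> r by (intro mult_left_mono s) simp
      also have "\<dots> = v2 * (T - t) powr (1 / 2) * exp (v * \<bar>x0 0\<bar> * t) * vnorm n (x 0)"
        unfolding v2_def using r by simp
      finally show ?thesis .
    qed
    have l1: "(x0 \<longlongrightarrow> 0) (at_left T)"
      by (rule tendsto_0_at_left_bound[OF T b1]) (auto intro!: tendsto_eq_intros simp: T less_imp_neq[OF T, symmetric])
    have l2: "((\<lambda>t. u0_fb T \<beta> t (x0 t)) \<longlongrightarrow> 0) (at_left T)"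
      by (rule tendsto_0_at_left_bound[OF T b2]) (auto intro!: tendsto_eq_intros)
    have lim: "((\<lambda>t. a * (T - t) powr p * exp (v * \<bar>x0 0\<bar> * t) * vnorm n (x 0)) \<longlongrightarrow> 0) (at_left T)"
      if "p > 0" for a p
    proof -
      have "((\<lambda>t. (T - t) powr p) \<longlongrightarrow> 0) (at_left T)"
      proof (rule tendsto_zero_powrI)
        show "((\<lambda>t. T - t) \<longlongrightarrow> 0) (at_left T)" by (auto intro!: tendsto_eq_intros)
        show "\<forall>\<^sub>F t in at_left T. 0 \<le> T - t"
          unfolding eventually_at_left[OF T] using T by (intro exI[of _ 0]) auto
      qed (use that in auto)
      then have "((\<lambda>t. a * (T - t) powr p * exp (v * \<bar>x0 0\<bar> * t) * vnorm n (x 0)) \<longlongrightarrow>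
          a * 0 * exp (v * \<bar>x0 0\<bar> * T) * vnorm n (x 0)) (at_left T)"
        by (intro tendsto_intros)
      then show ?thesis by simp
    qed
    have l3: "((\<lambda>t. x t i) \<longlongrightarrow> 0) (at_left T)" if "i \<in> {1..n}" for i
      by (rule tendsto_0_at_left_bound[OF T order_trans[OF abs_le_vnorm[OF that] b3]]) (auto intro: lim)
    have l4: "((\<lambda>t. u_fb n T \<beta> t (x t)) \<longlongrightarrow> 0) (at_left T)"
      by (rule tendsto_0_at_left_bound[OF T b4]) (auto intro: lim)
    show ?thesis using b1 b2 b3 b4 l1 l2 l3 l4 by blast
  qed
  show ?thesis
    unfolding \<beta>_def[symmetric]
    by (rule exI[of _ v1], rule exI[of _ v], rule exI[of _ v2], rule exI[of _ v],
        rule conjI[OF v1], rule conjI[OF v], rule conjI[OF v2], rule conjI[OF v],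
        intro allI impI, rule main[unfolded closed_loop_def \<beta>_def[symmetric]])
qed

end
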